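(* Let $\mathcal C$, $\Sigma_{\mathsf v}$, $\Sigma_{\mathsf c}$, $D$, $\Theta$, $\theta$ be as in the context, let $T$ be an $\omega$-continuous strong monad on $\mathcal C$, and let $(\rho^{\mathsf v},\rho^{\mathsf c},\chi)$ be a strongly separated abstract higher-order GSOS law whose distributive law $\chi$ is $\omega$-continuous. Let $\xi$ be the big-step transformation induced by $(\rho^{\mathsf v},\rho^{\mathsf c})$, let $\hat\zeta\colon\mu\Sigma\to TS_{\mathsf v}$ be the induced big-step semantics and $\hat\beta\colon\mu\Sigma\to TS_{\mathsf v}$ the multi-step small-step semantics (all as defined in the context). Then $\hat\zeta=\hat\beta$.
   Context: Conventions: $\mathcal C$ is a distributive category (finite products and coproducts, and the canonical morphisms $[\mathrm{id}\times\mathrm{inl},\mathrm{id}\times\mathrm{inr}]\colon X\times Y+X\times Z\to X\times(Y+Z)$ are isomorphisms). $\mathrm{inl},\mathrm{inr}$ are coproduct injections, $[f,g]$ copairing, $\langle f,g\rangle$ pairing, $\mathrm{fst},\mathrm{snd}$ projections, $\nabla=[\mathrm{id},\mathrm{id}]\colon X+X\to X$. Syntax: $\Sigma_{\mathsf v}\colon\mathcal C\to\mathcal C$ and $\Sigma_{\mathsf c}\colon\mathcal C\times\mathcal C\to\mathcal C$ are functors, and $\Sigma X=\Sigma_{\mathsf v}X+\Sigma_{\mathsf c}(X,X)$. Free $\Sigma$-algebras exist; $(\Sigma^\star,\eta^\Sigma,\mu^\Sigma)$ is the free monad on $\Sigma$ with algebra structures $\iota_X\colon\Sigma\Sigma^\star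 X\to\Sigma^\star X$; $\iota^{\mathsf v}=\iota\circ\mathrm{inl}\colon\Sigma_{\mathsf v}\Sigma^\star X\to\Sigma^\star X$, $\iota^{\mathsf c}=\iota\circ\mathrm{inr}\colon\Sigma_{\mathsf c}(\Sigma^\star X,\Sigma^\star X)\to\Sigma^\star X$. $\mu\Sigma=\Sigma^\star 0$ is the initial $\Sigma$-algebra with invertible structure $\iota\colon\Sigma\mu\Sigma\to\mu\Sigma$; $S_{\mathsf v}=\Sigma_{\mathsf v}(\mu\Sigma)$, $S_{\mathsf c}=\Sigma_{\mathsf c}(\mu\Sigma,\mu\Sigma)$, so $\iota^{-1}\colon\mu\Sigma\to S_{\mathsf v}+S_{\mathsf c}$. For every $X$, $\nabla^\sharp:=\mu^\Sigma_X\circ\Sigma^\star\nabla\colon\Sigma^\star(\Sigma^\star X+\Sigma^\star X)\to\Sigma^\star X$ (for $X=0$: $\nabla^\sharp\colon\Sigma^\star(\mu\Sigma+\mu\Sigma)\to\mu\Sigma$), and $\mu^\Sigma_0\colon\Sigma^\star\mu\Sigma\to\mu\Sigma$. Behaviour: $T$ is a strong monad with unit $\eta^T$, multiplication $m^T$, strength $\tau_{X,Y}\colon X\times TY\to T(X\times Y)$; for $f\colon X\to TZ$, $f^\sharp=m^T\circ Tf$; for $f\colon X\to TZ,g\colon Y\to TW$, $f\boxplus g=[T\mathrm{inl}\circ f,T\mathrm{inr}\circ g]\colon X+Y\to T(Z+W)$. $D\colon\mathcal C^{op}\times\mathcal C\to\mathcal C$ is a functor and $B(X,Y)=TD(X,Y)+TY$.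 A separated abstract higher-order GSOS law is a triple $(\rho^{\mathsf v},\rho^{\mathsf c},\chi)$ of: a family $\rho^{\mathsf v}_X\colon\Sigma_{\mathsf v}X\to D(X,\Sigma^\star X)$ dinatural in $X$; a family $\rho^{\mathsf c}_{X,Y}\colon\Sigma_{\mathsf c}(X\times B(X,Y),X)\to T\Sigma^\star(X+Y)$ dinatural in $X$ and natural in $Y$; and a family $\chi_{X,Y}\colon\Sigma_{\mathsf c}(TX,Y)\to T\Sigma_{\mathsf c}(X,Y)$, natural in $X,Y$, which for each $Y$ is a distributive law of the monad $T$ over the functor $\Sigma_{\mathsf c}(-,Y)$ ($\chi\circ\Sigma_{\mathsf c}(\eta^T,\mathrm{id})=\eta^T$, $\chi\circ\Sigma_{\mathsf c}(m^T,\mathrm{id})=m^T\circ T\chi\circ\chi$). Put $\rho^{\mathsf{cv}}_{X,Y}=\rho^{\mathsf c}_{X,Y}\circ\Sigma_{\mathsf c}(\mathrm{id}\times\mathrm{inl},\mathrm{id})\colon\Sigma_{\mathsf c}(X\times TD(X,Y),X)\to T\Sigma^\star(X+Y)$. Standing assumption: there are a functor $\Theta\colon\mathcal C\times\mathcal C\times\mathcal C\to\mathcal C$ and a natural transformation $\theta_{X,Y,Z}\colon\Theta(X,Y,Z)\to\Sigma_{\mathsf c}(X+Y,Z)$ such that $\Sigma_{\mathsf c}(X,Z)\xrightarrow{\Sigma_{\mathsf c}(\mathrm{inl},\mathrm{id})}\Sigma_{\mathsf c}(X+Y,Z)\xleftarrow{\theta}\Theta(X,Y,Z)$ is a coproduct,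 naturally in $X,Y,Z$. Strong separation: the law is strongly separated if for all $X,Y$, with $\theta=\theta_{X\times TD(X,Y),\,X\times TY,\,X}$ and $\delta=[\mathrm{id}\times\mathrm{inl},\mathrm{id}\times\mathrm{inr}]\colon X\times TD(X,Y)+X\times TY\to X\times B(X,Y)$, $\rho^{\mathsf c}_{X,Y}\circ\Sigma_{\mathsf c}(\delta,\mathrm{id}_X)\circ\theta=T(\iota^{\mathsf c}\circ\Sigma_{\mathsf c}(\eta^\Sigma,\eta^\Sigma))\circ\chi_{X+Y,X+Y}\circ\Sigma_{\mathsf c}((T\mathrm{fst}\circ\tau)\boxplus\mathrm{snd},\ \mathrm{inl})\circ\theta$ as morphisms $\Theta(X\times TD(X,Y),X\times TY,X)\to T\Sigma^\star(X+Y)$. Operational model: $\gamma^{\mathsf v}=\eta^T\circ D(\mathrm{id},\mu^\Sigma_0)\circ\rho^{\mathsf v}_{\mu\Sigma}\colon S_{\mathsf v}\to TD(\mu\Sigma,\mu\Sigma)$, and $\gamma^{\mathsf c}\colon S_{\mathsf c}\to T\mu\Sigma$ is the unique morphism with $\gamma^{\mathsf c}\circ\Sigma_{\mathsf c}(\iota,\mathrm{id})=T\nabla^\sharp\circ\rho^{\mathsf c}_{\mu\Sigma,\mu\Sigma}\circ\Sigma_{\mathsf c}(\langle\iota,\gamma^{\mathsf v}+\gamma^{\mathsf c}\rangle,\mathrm{id})$ as morphisms $\Sigma_{\mathsf c}(S_{\mathsf v}+S_{\mathsf c},\mu\Sigma)\to T\mu\Sigma$ (it exists and is unique). $\omega$-continuity: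 $T$ is $\omega$-continuous if every hom-set $\mathcal C(X,TY)$ carries a partial order $\sqsubseteq$ making it an $\omega$-cpo with least element $\bot$, such that Kleisli composition $(f,g)\mapsto g^\sharp\circ f$ is $\omega$-continuous (hence monotone) in each argument, $\tau\circ(\mathrm{id}\times\bigsqcup_i f_i)=\bigsqcup_i\tau\circ(\mathrm{id}\times f_i)$, $[\bigsqcup_i f_i,\bigsqcup_i g_i]=\bigsqcup_i[f_i,g_i]$, $\tau\circ(\mathrm{id}\times\bot)=\bot$ and $f^\sharp\circ\bot=\bot$. $\chi$ is $\omega$-continuous if each map $f\mapsto\chi_{Y,Z}\circ\Sigma_{\mathsf c}(f,\mathrm{id}_Z)$, $\mathcal C(X,TY)\to\mathcal C(\Sigma_{\mathsf c}(X,Z),T\Sigma_{\mathsf c}(Y,Z))$, is $\omega$-continuous. $\mu f.\,F(f)$ denotes the least fixpoint. Small-step multi-step semantics: $\beta=\mu f.\,[\eta^T,f]^\sharp\circ T\iota^{-1}\circ\gamma^{\mathsf c}\colon S_{\mathsf c}\to TS_{\mathsf v}$ and $\hat\beta=[\eta^T,\beta]\circ\iota^{-1}\colon\mu\Sigma\to TS_{\mathsf v}$. Big-step: $\xi_X=T\nabla^\sharp\circ\rho^{\mathsf{cv}}_{\Sigma^\star X,\Sigma^\star X}\circ\Sigma_{\mathsf c}(\langle\iota^{\mathsf v},\eta^T\circ D(\mathrm{id},\mu^\Sigma_X)\circ\rho^{\mathsf v}_{\Sigma^\star X}\rangle,\mathrm{id})\circ\Sigma_{\mathsf c}(\Sigma_{\mathsf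 v}\eta^\Sigma_X,\eta^\Sigma_X)\colon\Sigma_{\mathsf c}(\Sigma_{\mathsf v}X,X)\to T\Sigma^\star X$, and $\hat\zeta=\mu f.\,[\eta^T,\ f^\sharp\circ T\mu^\Sigma_0\circ\xi_{\mu\Sigma}^\sharp\circ\chi_{S_{\mathsf v},\mu\Sigma}\circ\Sigma_{\mathsf c}(f,\mathrm{id})]\circ\iota^{-1}\colon\mu\Sigma\to TS_{\mathsf v}$. *)

theory Defs
  imports Main
begin

text \<open>Categories. Every element of the type \<open>'o\<close> is an object; the arrows form a subset of the
  type \<open>'m\<close>. Composition is written in the usual applicative order.\<close>

record ('o, 'm) cat =
  arrs :: "'m set"
  src :: "'m \<Rightarrow> 'o"
  tgt :: "'m \<Rightarrow> 'o"
  idn :: "'o \<Rightarrow> 'm"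
  cmp :: "'m \<Rightarrow> 'm \<Rightarrow> 'm" (infixr "\<cdot>\<index>" 75)

definition hom :: "('o, 'm, 'x) cat_scheme \<Rightarrow> 'o \<Rightarrow> 'o \<Rightarrow> 'm set" where
  "hom C X Y = {f \<in> arrs C. src C f = X \<and> tgt C f = Y}"

locale category =
  fixes C :: "('o, 'm, 'x) cat_scheme" (structure)
  assumes idn_hom: "idn C X \<in> hom C X X"
    and cmp_hom: "\<lbrakk>f \<in> hom C X Y; g \<in> hom C Y Z\<rbrakk> \<Longrightarrow> g \<cdot> f \<in> hom C X Z"
    and cmp_idn_left: "f \<in> hom C X Y \<Longrightarrow> idn C Y \<cdot> f = f"
    and cmp_idn_right: "f \<in> hom C X Y \<Longrightarrow> f \<cdot> idn C X = f"
    and cmp_assoc: "\<lbrakk>f \<in> hom C W X; g \<in> hom C X Y; h \<in> hom C Y Z\<rbrakk>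
      \<Longrightarrow> (h \<cdot> g) \<cdot> f = h \<cdot> (g \<cdot> f)"

definition op_cat :: "('o, 'm, 'x) cat_scheme \<Rightarrow> ('o, 'm) cat" where
  "op_cat C = \<lparr>arrs = arrs C, src = tgt C, tgt = src C, idn = idn C, cmp = (\<lambda>g f. f \<cdot>\<^bsub>C\<^esub> g)\<rparr>"

definition prod_cat ::
  "('o, 'm, 'x) cat_scheme \<Rightarrow> ('p, 'n, 'y) cat_scheme \<Rightarrow> ('o \<times> 'p, 'm \<times> 'n) cat"
  (infixr "\<times>\<^sub>C" 80) where
  "A \<times>\<^sub>C B = \<lparr>arrs = arrs A \<times> arrs B,
     src = (\<lambda>(f, g). (src A f, src B g)),
     tgt = (\<lambda>(f, g). (tgt A f, tgt B g)),
     idn = (\<lambda>(X, Y). (idn A X, idn B Y)),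
     cmp = (\<lambda>(g, g') (f, f'). (g \<cdot>\<^bsub>A\<^esub> f, g' \<cdot>\<^bsub>B\<^esub> f'))\<rparr>"

definition is_iso :: "('o, 'm, 'x) cat_scheme \<Rightarrow> 'm \<Rightarrow> bool" where
  "is_iso C f \<longleftrightarrow> f \<in> arrs C \<and> (\<exists>g \<in> hom C (tgt C f) (src C f).
     g \<cdot>\<^bsub>C\<^esub> f = idn C (src C f) \<and> f \<cdot>\<^bsub>C\<^esub> g = idn C (tgt C f))"

definition inv_arr :: "('o, 'm, 'x) cat_scheme \<Rightarrow> 'm \<Rightarrow> 'm" where
  "inv_arr C f = (THE g. g \<in> hom C (tgt C f) (src C f) \<and>
     g \<cdot>\<^bsub>C\<^esub> f = idn C (src C f) \<and> f \<cdot>\<^bsub>C\<^esub> g = idn C (tgt C f))"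

definition is_coproduct ::
  "('o, 'm, 'x) cat_scheme \<Rightarrow> 'o \<Rightarrow> 'o \<Rightarrow> 'o \<Rightarrow> 'm \<Rightarrow> 'm \<Rightarrow> bool" where
  "is_coproduct C X Y P i j \<longleftrightarrow> i \<in> hom C X P \<and> j \<in> hom C Y P \<and>
     (\<forall>Z. \<forall>f \<in> hom C X Z. \<forall>g \<in> hom C Y Z.
        \<exists>!h. h \<in> hom C P Z \<and> h \<cdot>\<^bsub>C\<^esub> i = f \<and> h \<cdot>\<^bsub>C\<^esub> j = g)"


text \<open>Categories with chosen finite products \<open>\<otimes>\<close>, \<open>one\<close> and coproducts \<open>\<oplus>\<close>, \<open>zero\<close>.
  Projections and injections are indexed by both components.\<close>

record ('o, 'm) bicart = "('o, 'm) cat" +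
  prd :: "'o \<Rightarrow> 'o \<Rightarrow> 'o" (infixr "\<otimes>\<index>" 80)
  pfst :: "'o \<Rightarrow> 'o \<Rightarrow> 'm"
  psnd :: "'o \<Rightarrow> 'o \<Rightarrow> 'm"
  pair :: "'m \<Rightarrow> 'm \<Rightarrow> 'm" ("(\<open>indent=1\<close>\<langle>_,/ _\<rangle>\<index>)")
  one :: "'o"
  cop :: "'o \<Rightarrow> 'o \<Rightarrow> 'o" (infixr "\<oplus>\<index>" 78)
  cinl :: "'o \<Rightarrow> 'o \<Rightarrow> 'm"
  cinr :: "'o \<Rightarrow> 'o \<Rightarrow> 'm"
  copair :: "'m \<Rightarrow> 'm \<Rightarrow> 'm" ("(\<open>indent=1\<close>\<lblot>_,/ _\<rblot>\<index>)")
  zero :: "'o"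

definition pmap :: "('o, 'm, 'x) bicart_scheme \<Rightarrow> 'm \<Rightarrow> 'm \<Rightarrow> 'm" (infixr "\<otimes>\<^sub>m\<index>" 80) where
  "pmap C f g = \<langle>f \<cdot>\<^bsub>C\<^esub> pfst C (src C f) (src C g), g \<cdot>\<^bsub>C\<^esub> psnd C (src C f) (src C g)\<rangle>\<^bsub>C\<^esub>"

definition cmap :: "('o, 'm, 'x) bicart_scheme \<Rightarrow> 'm \<Rightarrow> 'm \<Rightarrow> 'm" (infixr "\<oplus>\<^sub>m\<index>" 78) where
  "cmap C f g = \<lblot>cinl C (tgt C f) (tgt C g) \<cdot>\<^bsub>C\<^esub> f, cinr C (tgt C f) (tgt C g) \<cdot>\<^bsub>C\<^esub> g\<rblot>\<^bsub>C\<^esub>"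

locale distributive_category = category C
  for C :: "('o, 'm) bicart" (structure) +
  assumes pfst_hom: "pfst C X Y \<in> hom C (X \<otimes> Y) X"
    and psnd_hom: "psnd C X Y \<in> hom C (X \<otimes> Y) Y"
    and pair_hom: "\<lbrakk>f \<in> hom C Z X; g \<in> hom C Z Y\<rbrakk> \<Longrightarrow> \<langle>f, g\<rangle> \<in> hom C Z (X \<otimes> Y)"
    and pfst_pair: "\<lbrakk>f \<in> hom C Z X; g \<in> hom C Z Y\<rbrakk> \<Longrightarrow> pfst C X Y \<cdot> \<langle>f, g\<rangle> = f"
    and psnd_pair: "\<lbrakk>f \<in> hom C Z X; g \<in> hom C Z Y\<rbrakk> \<Longrightarrow> psnd C X Y \<cdot> \<langle>f, g\<rangle> = g"
    and pair_unique: "h \<in> hom C Z (X \<otimes> Y) \<Longrightarrow> \<langle>pfst C X Y \<cdot> h, psnd C X Y \<cdot> h\<rangle> = h"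
    and terminal: "\<exists>!f. f \<in> hom C X (one C)"
    and cinl_hom: "cinl C X Y \<in> hom C X (X \<oplus> Y)"
    and cinr_hom: "cinr C X Y \<in> hom C Y (X \<oplus> Y)"
    and copair_hom: "\<lbrakk>f \<in> hom C X Z; g \<in> hom C Y Z\<rbrakk> \<Longrightarrow> \<lblot>f, g\<rblot> \<in> hom C (X \<oplus> Y) Z"
    and copair_cinl: "\<lbrakk>f \<in> hom C X Z; g \<in> hom C Y Z\<rbrakk> \<Longrightarrow> \<lblot>f, g\<rblot> \<cdot> cinl C X Y = f"
    and copair_cinr: "\<lbrakk>f \<in> hom C X Z; g \<in> hom C Y Z\<rbrakk> \<Longrightarrow> \<lblot>f, g\<rblot> \<cdot> cinr C X Y = g"
    and copair_unique: "h \<in> hom C (X \<oplus> Y) Z \<Longrightarrow> \<lblot>h \<cdot> cinl C X Y, h \<cdot> cinr C X Y\<rblot> = h"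
    and initial: "\<exists>!f. f \<in> hom C (zero C) X"
    and distributive: "is_iso C \<lblot>idn C X \<otimes>\<^sub>m cinl C Y Z, idn C X \<otimes>\<^sub>m cinr C Y Z\<rblot>"


record ('o, 'm, 'p, 'n) func =
  omap :: "'o \<Rightarrow> 'p"
  amap :: "'m \<Rightarrow> 'n"

definition is_functor ::
  "('o, 'm, 'x) cat_scheme \<Rightarrow> ('p, 'n, 'y) cat_scheme \<Rightarrow> ('o, 'm, 'p, 'n, 'z) func_scheme \<Rightarrow> bool"
  where
  "is_functor A B F \<longleftrightarrow>
     (\<forall>X Y. \<forall>f \<in> hom A X Y. amap F f \<in> hom B (omap F X) (omap F Y)) \<and>
     (\<forall>X. amap F (idn A X) = idn B (omap F X)) \<and>
     (\<forall>X Y Z. \<forall>f \<in> hom A X Y. \<forall>g \<in> hom A Y Z. amap F (g \<cdot>\<^bsub>A\<^esub> f) = amap F g \<cdot>\<^bsub>B\<^esub> amap F f)"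


text \<open>Strong monads, with unit \<open>munit\<close>, multiplication \<open>mmult\<close> and strength
  \<open>mstr X Y : X \<otimes> T Y \<rightarrow> T (X \<otimes> Y)\<close>.\<close>

record ('o, 'm) smonad = "('o, 'm, 'o, 'm) func" +
  munit :: "'o \<Rightarrow> 'm"
  mmult :: "'o \<Rightarrow> 'm"
  mstr :: "'o \<Rightarrow> 'o \<Rightarrow> 'm"

definition passoc :: "('o, 'm) bicart \<Rightarrow> 'o \<Rightarrow> 'o \<Rightarrow> 'o \<Rightarrow> 'm" where
  "passoc C X Y Z =
     \<langle>pfst C X Y \<cdot>\<^bsub>C\<^esub> pfst C (X \<otimes>\<^bsub>C\<^esub> Y) Z,
      \<langle>psnd C X Y \<cdot>\<^bsub>C\<^esub> pfst C (X \<otimes>\<^bsub>C\<^esub> Y) Z, psnd C (X \<otimes>\<^bsub>C\<^esub> Y) Z\<rangle>\<^bsub>C\<^esub>\<rangle>\<^bsub>C\<^esub>"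

locale strong_monad =
  fixes C :: "('o, 'm) bicart" (structure) and T :: "('o, 'm) smonad"
  assumes functor_T: "is_functor C C T"
    and munit_hom: "munit T X \<in> hom C X (omap T X)"
    and mmult_hom: "mmult T X \<in> hom C (omap T (omap T X)) (omap T X)"
    and mstr_hom: "mstr T X Y \<in> hom C (X \<otimes> omap T Y) (omap T (X \<otimes> Y))"
    and munit_natural: "f \<in> hom C X Y \<Longrightarrow> amap T f \<cdot> munit T X = munit T Y \<cdot> f"
    and mmult_natural: "f \<in> hom C X Y \<Longrightarrow>
      amap T f \<cdot> mmult T X = mmult T Y \<cdot> amap T (amap T f)"
    and mstr_natural: "\<lbrakk>f \<in> hom C X X'; g \<in> hom C Y Y'\<rbrakk> \<Longrightarrow>
      amap T (f \<otimes>\<^sub>m g) \<cdot> mstr T X Y = mstr T X' Y' \<cdot> (f \<otimes>\<^sub>m amap T g)"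
    and mmult_munit: "mmult T X \<cdot> munit T (omap T X) = idn C (omap T X)"
    and mmult_map_munit: "mmult T X \<cdot> amap T (munit T X) = idn C (omap T X)"
    and mmult_mmult: "mmult T X \<cdot> mmult T (omap T X) = mmult T X \<cdot> amap T (mmult T X)"
    and mstr_one: "amap T (psnd C (one C) X) \<cdot> mstr T (one C) X = psnd C (one C) (omap T X)"
    and mstr_assoc: "amap T (passoc C X Y Z) \<cdot> mstr T (X \<otimes> Y) Z =
      mstr T X (Y \<otimes> Z) \<cdot> (idn C X \<otimes>\<^sub>m mstr T Y Z) \<cdot> passoc C X Y (omap T Z)"
    and mstr_munit: "mstr T X Y \<cdot> (idn C X \<otimes>\<^sub>m munit T Y) = munit T (X \<otimes> Y)"
    and mstr_mmult: "mstr T X Y \<cdot> (idn C X \<otimes>\<^sub>m mmult T Y) =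
      mmult T (X \<otimes> Y) \<cdot> amap T (mstr T X Y) \<cdot> mstr T X (omap T Y)"

text \<open>Kleisli extension of \<open>f : X \<rightarrow> T Z\<close> and the sum of \<open>f : X \<rightarrow> T Z\<close> and \<open>g : Y \<rightarrow> T W\<close>. The
  objects \<open>Z\<close>, \<open>W\<close> are explicit since the target \<open>T Z\<close> of an arrow need not determine \<open>Z\<close>.\<close>

definition klift :: "('o, 'm) bicart \<Rightarrow> ('o, 'm) smonad \<Rightarrow> 'o \<Rightarrow> 'm \<Rightarrow> 'm" where
  "klift C T Z f = mmult T Z \<cdot>\<^bsub>C\<^esub> amap T f"

definition ksum :: "('o, 'm) bicart \<Rightarrow> ('o, 'm) smonad \<Rightarrow> 'o \<Rightarrow> 'o \<Rightarrow> 'm \<Rightarrow> 'm \<Rightarrow> 'm" where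
  "ksum C T Z W f g = \<lblot>amap T (cinl C Z W) \<cdot>\<^bsub>C\<^esub> f, amap T (cinr C Z W) \<cdot>\<^bsub>C\<^esub> g\<rblot>\<^bsub>C\<^esub>"


definition omega_chain :: "'a set \<Rightarrow> ('a \<Rightarrow> 'a \<Rightarrow> bool) \<Rightarrow> (nat \<Rightarrow> 'a) \<Rightarrow> bool" where
  "omega_chain A le f \<longleftrightarrow> (\<forall>i. f i \<in> A \<and> le (f i) (f (Suc i)))"

definition is_sup :: "'a set \<Rightarrow> ('a \<Rightarrow> 'a \<Rightarrow> bool) \<Rightarrow> (nat \<Rightarrow> 'a) \<Rightarrow> 'a \<Rightarrow> bool" where
  "is_sup A le f s \<longleftrightarrow> s \<in> A \<and> (\<forall>i. le (f i) s) \<and> (\<forall>u \<in> A. (\<forall>i. le (f i) u) \<longrightarrow> le s u)"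

definition is_bot :: "'a set \<Rightarrow> ('a \<Rightarrow> 'a \<Rightarrow> bool) \<Rightarrow> 'a \<Rightarrow> bool" where
  "is_bot A le b \<longleftrightarrow> b \<in> A \<and> (\<forall>u \<in> A. le b u)"

definition omega_cpo :: "'a set \<Rightarrow> ('a \<Rightarrow> 'a \<Rightarrow> bool) \<Rightarrow> bool" where
  "omega_cpo A le \<longleftrightarrow> reflp_on A le \<and> transp_on A le \<and> antisymp_on A le \<and>
     (\<forall>f. omega_chain A le f \<longrightarrow> (\<exists>s. is_sup A le f s)) \<and> (\<exists>b. is_bot A le b)"

text \<open>Monotonicity is implied: apply the condition to the chain \<open>x, y, y, \<dots>\<close>.\<close>

definition omega_cont ::
  "'a set \<Rightarrow> ('a \<Rightarrow> 'a \<Rightarrow> bool) \<Rightarrow> 'b set \<Rightarrow> ('b \<Rightarrow> 'b \<Rightarrow> bool) \<Rightarrow> ('a \<Rightarrow> 'b) \<Rightarrow> bool" where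
  "omega_cont A le A' le' \<Phi> \<longleftrightarrow>
     (\<forall>f s. omega_chain A le f \<longrightarrow> is_sup A le f s \<longrightarrow> is_sup A' le' (\<lambda>i. \<Phi> (f i)) (\<Phi> s))"

definition least_fixpoint :: "'a set \<Rightarrow> ('a \<Rightarrow> 'a \<Rightarrow> bool) \<Rightarrow> ('a \<Rightarrow> 'a) \<Rightarrow> 'a" where
  "least_fixpoint A le \<Phi> =
     (THE f. f \<in> A \<and> \<Phi> f = f \<and> (\<forall>g \<in> A. \<Phi> g = g \<longrightarrow> le f g))"

text \<open>\<open>le X Y\<close> is the order on the hom-set from \<open>X\<close> to \<open>T Y\<close>.\<close>

locale omega_continuous_monad = strong_monad C T
  for C :: "('o, 'm) bicart" (structure) and T :: "('o, 'm) smonad" +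
  fixes le :: "'o \<Rightarrow> 'o \<Rightarrow> 'm \<Rightarrow> 'm \<Rightarrow> bool"
  assumes hom_omega_cpo: "omega_cpo (hom C X (omap T Y)) (le X Y)"
    and klift_cont_left: "g \<in> hom C Y (omap T Z) \<Longrightarrow>
      omega_cont (hom C X (omap T Y)) (le X Y) (hom C X (omap T Z)) (le X Z)
        (\<lambda>f. klift C T Z g \<cdot> f)"
    and klift_cont_right: "f \<in> hom C X (omap T Y) \<Longrightarrow>
      omega_cont (hom C Y (omap T Z)) (le Y Z) (hom C X (omap T Z)) (le X Z)
        (\<lambda>g. klift C T Z g \<cdot> f)"
    and mstr_cont:
      "omega_cont (hom C X (omap T Y)) (le X Y)
        (hom C (W \<otimes> X) (omap T (W \<otimes> Y))) (le (W \<otimes> X) (W \<otimes> Y))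
        (\<lambda>f. mstr T W Y \<cdot> (idn C W \<otimes>\<^sub>m f))"
    and copair_cont:
      "\<lbrakk>omega_chain (hom C X (omap T Z)) (le X Z) fs; is_sup (hom C X (omap T Z)) (le X Z) fs s;
        omega_chain (hom C Y (omap T Z)) (le Y Z) gs; is_sup (hom C Y (omap T Z)) (le Y Z) gs t\<rbrakk> \<Longrightarrow>
       is_sup (hom C (X \<oplus> Y) (omap T Z)) (le (X \<oplus> Y) Z) (\<lambda>i. \<lblot>fs i, gs i\<rblot>) \<lblot>s, t\<rblot>"
    and mstr_bot: "is_bot (hom C X (omap T Y)) (le X Y) b \<Longrightarrow>
      is_bot (hom C (W \<otimes> X) (omap T (W \<otimes> Y))) (le (W \<otimes> X) (W \<otimes> Y))
        (mstr T W Y \<cdot> (idn C W \<otimes>\<^sub>m b))"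
    and klift_bot: "\<lbrakk>f \<in> hom C Y (omap T Z); is_bot (hom C X (omap T Y)) (le X Y) b\<rbrakk> \<Longrightarrow>
      is_bot (hom C X (omap T Z)) (le X Z) (klift C T Z f \<cdot> b)"


definition sig_functor :: "('o, 'm) bicart \<Rightarrow> ('o, 'm, 'o, 'm) func \<Rightarrow>
    ('o \<times> 'o, 'm \<times> 'm, 'o, 'm) func \<Rightarrow> ('o, 'm, 'o, 'm) func" where
  "sig_functor C Sv Sc =
     \<lparr>omap = (\<lambda>X. omap Sv X \<oplus>\<^bsub>C\<^esub> omap Sc (X, X)), amap = (\<lambda>f. amap Sv f \<oplus>\<^sub>m\<^bsub>C\<^esub> amap Sc (f, f))\<rparr>"

text \<open>A choice of free algebras on all objects \<open>X\<close>: carrier \<open>fobj F X\<close>, universal arrow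
  \<open>funit F X : X \<rightarrow> fobj F X\<close> and algebra structure \<open>falg F X : S (fobj F X) \<rightarrow> fobj F X\<close>.\<close>

record ('o, 'm) free_algs =
  fobj :: "'o \<Rightarrow> 'o"
  funit :: "'o \<Rightarrow> 'm"
  falg :: "'o \<Rightarrow> 'm"

definition is_free_ext :: "('o, 'm) bicart \<Rightarrow> ('o, 'm, 'o, 'm) func \<Rightarrow> ('o, 'm) free_algs \<Rightarrow>
    'o \<Rightarrow> 'o \<Rightarrow> 'm \<Rightarrow> 'm \<Rightarrow> 'm \<Rightarrow> bool" where
  "is_free_ext C S F X A a f h \<longleftrightarrow> h \<in> hom C (fobj F X) A \<and>
     h \<cdot>\<^bsub>C\<^esub> funit F X = f \<and> h \<cdot>\<^bsub>C\<^esub> falg F X = a \<cdot>\<^bsub>C\<^esub> amap S h"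

definition free_algebras ::
  "('o, 'm) bicart \<Rightarrow> ('o, 'm, 'o, 'm) func \<Rightarrow> ('o, 'm) free_algs \<Rightarrow> bool" where
  "free_algebras C S F \<longleftrightarrow> (\<forall>X.
     funit F X \<in> hom C X (fobj F X) \<and> falg F X \<in> hom C (omap S (fobj F X)) (fobj F X) \<and>
     (\<forall>A. \<forall>a \<in> hom C (omap S A) A. \<forall>f \<in> hom C X A. \<exists>!h. is_free_ext C S F X A a f h))"

definition free_functor :: "('o, 'm) bicart \<Rightarrow> ('o, 'm, 'o, 'm) func \<Rightarrow> ('o, 'm) free_algs \<Rightarrow>
    ('o, 'm, 'o, 'm) func" where
  "free_functor C S F = \<lparr>omap = fobj F,
     amap = (\<lambda>f. THE h. is_free_ext C S F (src C f) (fobj F (tgt C f)) (falg F (tgt C f))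
        (funit F (tgt C f) \<cdot>\<^bsub>C\<^esub> f) h)\<rparr>"

definition free_mult :: "('o, 'm) bicart \<Rightarrow> ('o, 'm, 'o, 'm) func \<Rightarrow> ('o, 'm) free_algs \<Rightarrow>
    'o \<Rightarrow> 'm" where
  "free_mult C S F X =
     (THE h. is_free_ext C S F (fobj F X) (fobj F X) (falg F X) (idn C (fobj F X)) h)"


text \<open>The locale \<open>hogsos\<close> fixes the data without assumptions. \<open>mu\<close> is the initial algebra
  \<open>\<mu>\<Sigma>\<close>, and \<open>V\<close>, \<open>K\<close> are the objects \<open>S\<^sub>v\<close>, \<open>S\<^sub>c\<close> of values and computations. The arrow
  \<open>gamma_c\<close> and the inverse of \<open>iota\<close> are described uniquely once the functors, free algebras and
  the law satisfy their axioms; \<open>le\<close> in the least fixpoints is the order of the monad.\<close>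

locale hogsos =
  fixes C :: "('o, 'm) bicart" (structure)
    and Sv :: "('o, 'm, 'o, 'm) func"
    and Sc :: "('o \<times> 'o, 'm \<times> 'm, 'o, 'm) func"
    and F :: "('o, 'm) free_algs"
    and T :: "('o, 'm) smonad"
    and D :: "('o \<times> 'o, 'm \<times> 'm, 'o, 'm) func"
    and \<rho>v :: "'o \<Rightarrow> 'm"
    and \<rho>c :: "'o \<Rightarrow> 'o \<Rightarrow> 'm"
    and \<chi> :: "'o \<Rightarrow> 'o \<Rightarrow> 'm"
begin

abbreviation "Svo X \<equiv> omap Sv X"
abbreviation "Sva f \<equiv> amap Sv f"
abbreviation "Sco X Y \<equiv> omap Sc (X, Y)"
abbreviation "Sca f g \<equiv> amap Sc (f, g)"
abbreviation "To X \<equiv> omap T X"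
abbreviation "Ta f \<equiv> amap T f"
abbreviation "Do X Y \<equiv> omap D (X, Y)"
abbreviation "Da f g \<equiv> amap D (f, g)"
abbreviation "S \<equiv> sig_functor C Sv Sc"
abbreviation "Fo X \<equiv> fobj F X"
abbreviation "Fa f \<equiv> amap (free_functor C S F) f"
abbreviation "Fmult X \<equiv> free_mult C S F X"

definition B :: "('o \<times> 'o, 'm \<times> 'm, 'o, 'm) func" where
  "B = \<lparr>omap = (\<lambda>(X, Y). To (Do X Y) \<oplus> To Y), amap = (\<lambda>(f, g). Ta (Da f g) \<oplus>\<^sub>m Ta g)\<rparr>"

abbreviation "Bo X Y \<equiv> omap B (X, Y)"
abbreviation "Ba f g \<equiv> amap B (f, g)"

definition iota_v :: "'o \<Rightarrow> 'm" where
  "iota_v X = falg F X \<cdot> cinl C (Svo (Fo X)) (Sco (Fo X) (Fo X))"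

definition iota_c :: "'o \<Rightarrow> 'm" where
  "iota_c X = falg F X \<cdot> cinr C (Svo (Fo X)) (Sco (Fo X) (Fo X))"

definition nabla_sharp :: "'o \<Rightarrow> 'm" where
  "nabla_sharp X = Fmult X \<cdot> Fa \<lblot>idn C (Fo X), idn C (Fo X)\<rblot>"

definition mu :: "'o" where
  "mu = Fo (zero C)"

definition iota :: "'m" where
  "iota = falg F (zero C)"

definition V :: "'o" where
  "V = Svo mu"

definition K :: "'o" where
  "K = Sco mu mu"

definition rho_cv :: "'o \<Rightarrow> 'o \<Rightarrow> 'm" where
  "rho_cv X Y = \<rho>c X Y \<cdot> Sca (idn C X \<otimes>\<^sub>m cinl C (To (Do X Y)) (To Y)) (idn C X)"

definition gamma_v :: "'m" where
  "gamma_v = munit T (Do mu mu) \<cdot> Da (idn C mu) (Fmult (zero C)) \<cdot> \<rho>v mu"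

definition gamma_c :: "'m" where
  "gamma_c = (THE g. g \<in> hom C K (To mu) \<and>
     g \<cdot> Sca iota (idn C mu) =
       Ta (nabla_sharp (zero C)) \<cdot> \<rho>c mu mu \<cdot> Sca \<langle>iota, gamma_v \<oplus>\<^sub>m g\<rangle> (idn C mu))"

definition xi :: "'o \<Rightarrow> 'm" where
  "xi X = Ta (nabla_sharp X) \<cdot> rho_cv (Fo X) (Fo X)
     \<cdot> Sca \<langle>iota_v X,
            munit T (Do (Fo X) (Fo X)) \<cdot> Da (idn C (Fo X)) (Fmult X) \<cdot> \<rho>v (Fo X)\<rangle>
           (idn C (Fo X))
     \<cdot> Sca (Sva (funit F X)) (funit F X)"

definition beta :: "('o \<Rightarrow> 'o \<Rightarrow> 'm \<Rightarrow> 'm \<Rightarrow> bool) \<Rightarrow> 'm" where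
  "beta le = least_fixpoint (hom C K (To V)) (le K V)
     (\<lambda>f. klift C T V \<lblot>munit T V, f\<rblot> \<cdot> Ta (inv_arr C iota) \<cdot> gamma_c)"

definition beta_hat :: "('o \<Rightarrow> 'o \<Rightarrow> 'm \<Rightarrow> 'm \<Rightarrow> bool) \<Rightarrow> 'm" where
  "beta_hat le = \<lblot>munit T V, beta le\<rblot> \<cdot> inv_arr C iota"

definition zeta_hat :: "('o \<Rightarrow> 'o \<Rightarrow> 'm \<Rightarrow> 'm \<Rightarrow> bool) \<Rightarrow> 'm" where
  "zeta_hat le = least_fixpoint (hom C mu (To V)) (le mu V)
     (\<lambda>f. \<lblot>munit T V,
            klift C T V f \<cdot> Ta (Fmult (zero C)) \<cdot> klift C T (Fo mu) (xi mu)
              \<cdot> \<chi> V mu \<cdot> Sca f (idn C mu)\<rblot>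
          \<cdot> inv_arr C iota)"

definition strongly_separated :: "('o \<Rightarrow> 'o \<Rightarrow> 'o \<Rightarrow> 'm) \<Rightarrow> bool" where
  "strongly_separated \<theta> \<longleftrightarrow> (\<forall>X Y.
     let P = X \<otimes> To (Do X Y); Q = X \<otimes> To Y;
         \<delta> = \<lblot>idn C X \<otimes>\<^sub>m cinl C (To (Do X Y)) (To Y), idn C X \<otimes>\<^sub>m cinr C (To (Do X Y)) (To Y)\<rblot>
     in \<rho>c X Y \<cdot> Sca \<delta> (idn C X) \<cdot> \<theta> P Q X =
        Ta (iota_c (X \<oplus> Y) \<cdot> Sca (funit F (X \<oplus> Y)) (funit F (X \<oplus> Y)))
          \<cdot> \<chi> (X \<oplus> Y) (X \<oplus> Y)
          \<cdot> Sca (ksum C T X Y (Ta (pfst C X (Do X Y)) \<cdot> mstr T X (Do X Y)) (psnd C X (To Y)))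
                (cinl C X Y)
          \<cdot> \<theta> P Q X)"

definition chi_omega_continuous :: "('o \<Rightarrow> 'o \<Rightarrow> 'm \<Rightarrow> 'm \<Rightarrow> bool) \<Rightarrow> bool" where
  "chi_omega_continuous le \<longleftrightarrow> (\<forall>X Y Z.
     omega_cont (hom C X (To Y)) (le X Y)
       (hom C (Sco X Z) (To (Sco Y Z))) (le (Sco X Z) (Sco Y Z))
       (\<lambda>f. \<chi> Y Z \<cdot> Sca f (idn C Z)))"

end

locale separated_law = hogsos +
  assumes \<rho>v_hom: "\<rho>v X \<in> hom C (Svo X) (Do X (Fo X))"
    and \<rho>v_dinatural: "f \<in> hom C X X' \<Longrightarrow>
      Da (idn C X) (Fa f) \<cdot> \<rho>v X = Da f (idn C (Fo X')) \<cdot> \<rho>v X' \<cdot> Sva f"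
    and \<rho>c_hom: "\<rho>c X Y \<in> hom C (Sco (X \<otimes> Bo X Y) X) (To (Fo (X \<oplus> Y)))"
    and \<rho>c_dinatural: "f \<in> hom C X X' \<Longrightarrow>
      Ta (Fa (f \<oplus>\<^sub>m idn C Y)) \<cdot> \<rho>c X Y \<cdot> Sca (idn C X \<otimes>\<^sub>m Ba f (idn C Y)) (idn C X) =
      \<rho>c X' Y \<cdot> Sca (f \<otimes>\<^sub>m idn C (Bo X' Y)) f"
    and \<rho>c_natural: "g \<in> hom C Y Y' \<Longrightarrow>
      Ta (Fa (idn C X \<oplus>\<^sub>m g)) \<cdot> \<rho>c X Y =
      \<rho>c X Y' \<cdot> Sca (idn C X \<otimes>\<^sub>m Ba (idn C X) g) (idn C X)"
    and \<chi>_hom: "\<chi> X Y \<in> hom C (Sco (To X) Y) (To (Sco X Y))"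
    and \<chi>_natural: "\<lbrakk>f \<in> hom C X X'; g \<in> hom C Y Y'\<rbrakk> \<Longrightarrow>
      Ta (Sca f g) \<cdot> \<chi> X Y = \<chi> X' Y' \<cdot> Sca (Ta f) g"
    and \<chi>_munit: "\<chi> X Y \<cdot> Sca (munit T X) (idn C Y) = munit T (Sco X Y)"
    and \<chi>_mmult: "\<chi> X Y \<cdot> Sca (mmult T X) (idn C Y) =
      mmult T (Sco X Y) \<cdot> Ta (\<chi> X Y) \<cdot> \<chi> (To X) Y"

locale computation_splitting =
  fixes C :: "('o, 'm) bicart" (structure)
    and Sc :: "('o \<times> 'o, 'm \<times> 'm, 'o, 'm) func"
    and \<Theta> :: "('o \<times> 'o \<times> 'o, 'm \<times> 'm \<times> 'm, 'o, 'm) func"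
    and \<theta> :: "'o \<Rightarrow> 'o \<Rightarrow> 'o \<Rightarrow> 'm"
  assumes functor_\<Theta>: "is_functor (C \<times>\<^sub>C C \<times>\<^sub>C C) C \<Theta>"
    and \<theta>_natural: "\<lbrakk>f \<in> hom C X X'; g \<in> hom C Y Y'; h \<in> hom C Z Z'\<rbrakk> \<Longrightarrow>
      amap Sc (f \<oplus>\<^sub>m g, h) \<cdot> \<theta> X Y Z = \<theta> X' Y' Z' \<cdot> amap \<Theta> (f, g, h)"
    and coproduct: "is_coproduct C (omap Sc (X, Z)) (omap \<Theta> (X, Y, Z)) (omap Sc (X \<oplus> Y, Z))
      (amap Sc (cinl C X Y, idn C Z)) (\<theta> X Y Z)"

end

theory Submission
  imports Defs
begin

text \<open>
  Every computation is either a redex, an element of \<open>\<Sigma>\<^sub>c(S\<^sub>v, \<mu>\<Sigma>)\<close>, or a context, an element of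
  the complement \<open>\<Theta>\<close> where the active argument is itself a computation. Let \<open>redex_step\<close> be the
  restriction of \<open>\<gamma>\<^sub>c\<close> to redexes, \<open>total_step = \<lblot>\<eta> \<cdot> \<iota>\<^sub>v, \<gamma>\<^sub>c\<rblot> \<cdot> \<iota>\<^sup>-\<^sup>1\<close>,
  \<open>context_step = \<chi> \<cdot> \<Sigma>\<^sub>c(total_step, id)\<close> and \<open>hat f = \<lblot>\<eta>, f\<rblot> \<cdot> \<iota>\<^sup>-\<^sup>1\<close>; write \<open>f\<^sup>#\<close> for Kleisli
  extension. Since \<open>redex_step\<close> is natural in algebra morphisms, \<open>T \<mu> \<cdot> \<xi> = redex_step\<close>; strong
  separation says that \<open>\<gamma>\<^sub>c\<close> is \<open>T \<iota>\<^sub>c \<cdot> context_step\<close> on contexts.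

  Hence \<open>\<beta>\<close> is the least fixpoint of \<open>f \<mapsto> G f f\<close>, where \<open>G g f\<close> is \<open>(hat g)\<^sup># \<cdot> redex_step\<close> on
  redexes and \<open>f\<^sup># \<cdot> context_step\<close> on contexts, and so also the least fixpoint of \<open>G \<beta>\<close>. With
  \<open>p = (hat \<beta>)\<^sup># \<cdot> redex_step\<close>, the map \<open>A f = p\<^sup># \<cdot> \<chi> \<cdot> \<Sigma>\<^sub>c(hat f, id)\<close> intertwines \<open>f \<mapsto> G f f\<close>
  with \<open>G \<beta>\<close>, so by fixpoint fusion \<open>A \<beta>\<close> is the least fixpoint of \<open>G \<beta>\<close> too. The resulting
  equation \<open>\<beta> = A \<beta>\<close> says that \<open>hat \<beta>\<close> is a fixpoint of the big-step functional.

  Conversely, if \<open>z\<close> is any fixpoint of the big-step functional, then \<open>z\<close> and \<open>z\<^sup># \<cdot> total_step\<close>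
  satisfy the same structural recursion over the initial algebra, hence coincide. So \<open>z \<cdot> \<iota>\<^sub>c\<close> is a
  fixpoint of the small-step functional and \<open>\<beta>\<close> lies below it.
\<close>

section \<open>Least fixpoints in omega-cpos\<close>

lemma omega_cpo_refl: "\<lbrakk>omega_cpo A le; x \<in> A\<rbrakk> \<Longrightarrow> le x x"
  unfolding omega_cpo_def by (meson reflp_onD)

lemma omega_cpo_antisym: "\<lbrakk>omega_cpo A le; le x y; le y x; x \<in> A; y \<in> A\<rbrakk> \<Longrightarrow> x = y"
  unfolding omega_cpo_def by (meson antisymp_onD)

lemma omega_chain_const: "\<lbrakk>omega_cpo A le; x \<in> A\<rbrakk> \<Longrightarrow> omega_chain A le (\<lambda>_. x)"
  unfolding omega_chain_def by (auto intro: omega_cpo_refl)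

lemma is_sup_const: "\<lbrakk>omega_cpo A le; x \<in> A\<rbrakk> \<Longrightarrow> is_sup A le (\<lambda>_. x) x"
  unfolding is_sup_def by (auto intro: omega_cpo_refl)

lemma is_sup_unique: "\<lbrakk>omega_cpo A le; is_sup A le f s; is_sup A le f t\<rbrakk> \<Longrightarrow> s = t"
  unfolding is_sup_def by (rule omega_cpo_antisym[of A le]) blast+

lemma
  assumes "omega_cpo A le" "x \<in> A" "y \<in> A" "le x y"
  shows omega_chain_two: "omega_chain A le (\<lambda>n. if n = 0 then x else y)"
    and is_sup_two: "is_sup A le (\<lambda>n. if n = 0 then x else y) y"
  using assms unfolding omega_chain_def is_sup_def by (auto intro: omega_cpo_refl)

lemma omega_cont_closed:
  assumes "omega_cont A le A' le' \<Phi>" "omega_cpo A le" "x \<in> A"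
  shows "\<Phi> x \<in> A'"
  using assms is_sup_const[of A le x] omega_chain_const[of A le x]
  unfolding omega_cont_def is_sup_def by blast

lemma omega_cont_mono:
  assumes "omega_cont A le A' le' \<Phi>" "omega_cpo A le" "le x y" "x \<in> A" "y \<in> A"
  shows "le' (\<Phi> x) (\<Phi> y)"
proof -
  have "is_sup A' le' (\<lambda>n. \<Phi> (if n = (0::nat) then x else y)) (\<Phi> y)"
    using assms omega_chain_two[of A le x y] is_sup_two[of A le x y]
    unfolding omega_cont_def by blast
  then have "le' (\<Phi> (if (0::nat) = 0 then x else y)) (\<Phi> y)"
    unfolding is_sup_def by blast
  then show ?thesis by simp
qed

lemma omega_cont_chain:
  assumes "omega_cont A le A' le' \<Phi>" "omega_cpo A le" "omega_chain A le f"
  shows "omega_chain A' le' (\<lambda>i. \<Phi> (f i))"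
  using assms omega_cont_closed[OF assms(1,2)] omega_cont_mono[OF assms(1,2)]
  unfolding omega_chain_def by blast

lemma omega_cont_compose:
  assumes "omega_cont A le A' le' \<Phi>" "omega_cont A' le' A'' le'' \<Psi>" "omega_cpo A le"
  shows "omega_cont A le A'' le'' (\<lambda>x. \<Psi> (\<Phi> x))"
  using assms omega_cont_chain[OF assms(1,3)] unfolding omega_cont_def by blast

lemma omega_cont_cong:
  assumes "omega_cont A le A' le' \<Phi>" "\<And>x. x \<in> A \<Longrightarrow> \<Phi> x = \<Psi> x"
  shows "omega_cont A le A' le' \<Psi>"
  using assms unfolding omega_cont_def omega_chain_def is_sup_def by simp

definition is_least_fixpoint :: "'a set \<Rightarrow> ('a \<Rightarrow> 'a \<Rightarrow> bool) \<Rightarrow> ('a \<Rightarrow> 'a) \<Rightarrow> 'a \<Rightarrow> bool" where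
  "is_least_fixpoint A le \<Phi> s \<longleftrightarrow> s \<in> A \<and> \<Phi> s = s \<and> (\<forall>g \<in> A. \<Phi> g = g \<longrightarrow> le s g)"

lemma least_fixpoint_eqI:
  "\<lbrakk>omega_cpo A le; is_least_fixpoint A le \<Phi> s\<rbrakk> \<Longrightarrow> least_fixpoint A le \<Phi> = s"
  unfolding least_fixpoint_def is_least_fixpoint_def
  by (intro the_equality) (auto intro: omega_cpo_antisym)

lemma is_least_fixpoint_unique:
  "\<lbrakk>omega_cpo A le; is_least_fixpoint A le \<Phi> s; is_least_fixpoint A le \<Phi> t\<rbrakk> \<Longrightarrow> s = t"
  using least_fixpoint_eqI by metis

lemma least_fixpoint_cong:
  "(\<And>f. f \<in> A \<Longrightarrow> \<Phi> f = \<Psi> f) \<Longrightarrow> least_fixpoint A le \<Phi> = least_fixpoint A le \<Psi>"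
  unfolding least_fixpoint_def by (rule arg_cong[of _ _ The]) auto

context
  fixes A :: "'a set" and le :: "'a \<Rightarrow> 'a \<Rightarrow> bool" and \<Phi> :: "'a \<Rightarrow> 'a"
  assumes cpo: "omega_cpo A le" and cont: "omega_cont A le A le \<Phi>"
begin

lemma iterate_in: "is_bot A le b \<Longrightarrow> (\<Phi> ^^ n) b \<in> A"
  by (induction n) (auto simp: is_bot_def omega_cont_closed[OF cont cpo])

lemma omega_chain_iterate:
  assumes "is_bot A le b"
  shows "omega_chain A le (\<lambda>n. (\<Phi> ^^ n) b)"
proof -
  have "le ((\<Phi> ^^ n) b) ((\<Phi> ^^ Suc n) b)" for n
  proof (induction n)
    case 0
    then show ?case using assms iterate_in[OF assms, of 1] by (simp add: is_bot_def)
  next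
    case (Suc n)
    then show ?case
      using omega_cont_mono[OF cont cpo, of "(\<Phi> ^^ n) b"] iterate_in[OF assms, of n]
        iterate_in[OF assms, of "Suc n"] by simp
  qed
  then show ?thesis using iterate_in[OF assms] unfolding omega_chain_def by blast
qed

lemma is_least_fixpoint_sup_iterate:
  assumes b: "is_bot A le b" and s: "is_sup A le (\<lambda>n. (\<Phi> ^^ n) b) s"
  shows "is_least_fixpoint A le \<Phi> s"
proof -
  have "is_sup A le (\<lambda>n. (\<Phi> ^^ Suc n) b) (\<Phi> s)"
    using cont omega_chain_iterate[OF b] s unfolding omega_cont_def by auto
  moreover have "is_sup A le (\<lambda>n. (\<Phi> ^^ Suc n) b) s"
    using s b unfolding is_sup_def is_bot_def by (metis funpow_0 not0_implies_Suc)
  ultimately have "\<Phi> s = s" by (rule is_sup_unique[OF cpo])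
  moreover have "le s g" if g: "g \<in> A" "\<Phi> g = g" for g
  proof -
    have "le ((\<Phi> ^^ n) b) g" for n
    proof (induction n)
      case 0
      then show ?case using b g by (simp add: is_bot_def)
    next
      case (Suc n)
      then show ?case using omega_cont_mono[OF cont cpo Suc iterate_in[OF b] g(1)] g(2) by simp
    qed
    then show ?thesis using s g unfolding is_sup_def by blast
  qed
  ultimately show ?thesis using s unfolding is_least_fixpoint_def is_sup_def by blast
qed

lemma kleene_fixpoint:
  obtains b where "is_bot A le b" "is_sup A le (\<lambda>n. (\<Phi> ^^ n) b) (least_fixpoint A le \<Phi>)"
proof -
  obtain b where b: "is_bot A le b" using cpo unfolding omega_cpo_def by blast
  obtain s where s: "is_sup A le (\<lambda>n. (\<Phi> ^^ n) b) s"
    using cpo omega_chain_iterate[OF b] unfolding omega_cpo_def by blast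
  have "least_fixpoint A le \<Phi> = s"
    by (rule least_fixpoint_eqI[OF cpo is_least_fixpoint_sup_iterate[OF b s]])
  then show ?thesis using that[OF b] s by blast
qed

lemma is_least_fixpoint_least_fixpoint: "is_least_fixpoint A le \<Phi> (least_fixpoint A le \<Phi>)"
  by (rule kleene_fixpoint) (rule is_least_fixpoint_sup_iterate)

lemma least_fixpoint_induct [case_names bot step sup]:
  assumes bot: "\<And>b. is_bot A le b \<Longrightarrow> P b"
    and step: "\<And>f. \<lbrakk>f \<in> A; P f\<rbrakk> \<Longrightarrow> P (\<Phi> f)"
    and sup: "\<And>f s. \<lbrakk>omega_chain A le f; is_sup A le f s; \<And>i. P (f i)\<rbrakk> \<Longrightarrow> P s"
  shows "P (least_fixpoint A le \<Phi>)"
proof (rule kleene_fixpoint)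
  fix b
  assume b: "is_bot A le b" and s: "is_sup A le (\<lambda>n. (\<Phi> ^^ n) b) (least_fixpoint A le \<Phi>)"
  have "P ((\<Phi> ^^ n) b)" for n
    by (induction n) (use bot[OF b] step iterate_in[OF b] in auto)
  then show ?thesis using sup[OF omega_chain_iterate[OF b] s] by blast
qed

lemma least_fixpoint_diagonal:
  assumes diagonal: "\<And>f. f \<in> A \<Longrightarrow> \<Phi> f = G f f"
    and mono: "\<And>f f' g g'. \<lbrakk>le f f'; le g g'; f \<in> A; f' \<in> A; g \<in> A; g' \<in> A\<rbrakk> \<Longrightarrow> le (G f g) (G f' g')"
  shows "is_least_fixpoint A le (G (least_fixpoint A le \<Phi>)) (least_fixpoint A le \<Phi>)"
proof -
  let ?s = "least_fixpoint A le \<Phi>"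
  have s: "?s \<in> A" "\<Phi> ?s = ?s"
    using is_least_fixpoint_least_fixpoint unfolding is_least_fixpoint_def by auto
  have "le ?s g" if g: "g \<in> A" "G ?s g = g" for g
  proof -
    have "?s \<in> A \<and> le ?s ?s \<and> le ?s g"
    proof (rule least_fixpoint_induct[where P = "\<lambda>f. f \<in> A \<and> le f ?s \<and> le f g"])
      show "b \<in> A \<and> le b ?s \<and> le b g" if "is_bot A le b" for b
        using that s g unfolding is_bot_def by blast
      show "\<Phi> f \<in> A \<and> le (\<Phi> f) ?s \<and> le (\<Phi> f) g" if f: "f \<in> A" "f \<in> A \<and> le f ?s \<and> le f g" for f
        using mono[of f ?s f ?s] mono[of f ?s f g] diagonal[OF f(1)] diagonal[OF s(1)] f g s
          omega_cont_closed[OF cont cpo f(1)] by simp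
      show "t \<in> A \<and> le t ?s \<and> le t g"
        if "is_sup A le f t" "\<And>i. f i \<in> A \<and> le (f i) ?s \<and> le (f i) g" for f t
        using that s g unfolding is_sup_def by blast
    qed
    then show ?thesis by blast
  qed
  then show ?thesis using s diagonal[OF s(1)] unfolding is_least_fixpoint_def by simp
qed

text \<open>Strictness of \<open>h\<close> is relaxed: its value at the bottom need only lie below the fixpoints of
  \<open>\<Psi>\<close>.\<close>

lemma least_fixpoint_fusion:
  assumes h: "omega_cont A le A' le' h"
    and fusion: "\<And>f. f \<in> A \<Longrightarrow> h (\<Phi> f) = \<Psi> (h f)"
    and mono: "\<And>f g. \<lbrakk>le' f g; f \<in> A'; g \<in> A'\<rbrakk> \<Longrightarrow> le' (\<Psi> f) (\<Psi> g)"
    and bot: "\<And>b g. \<lbrakk>is_bot A le b; g \<in> A'; \<Psi> g = g\<rbrakk> \<Longrightarrow> le' (h b) g"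
  shows "is_least_fixpoint A' le' \<Psi> (h (least_fixpoint A le \<Phi>))"
proof -
  let ?s = "least_fixpoint A le \<Phi>"
  have s: "?s \<in> A" "\<Phi> ?s = ?s"
    using is_least_fixpoint_least_fixpoint unfolding is_least_fixpoint_def by auto
  have "le' (h ?s) g" if g: "g \<in> A'" "\<Psi> g = g" for g
  proof (rule least_fixpoint_induct[where P = "\<lambda>f. le' (h f) g"])
    show "le' (h b) g" if "is_bot A le b" for b by (rule bot[OF that g])
    show "le' (h (\<Phi> f)) g" if "f \<in> A" "le' (h f) g" for f
      using mono[OF that(2) omega_cont_closed[OF h cpo that(1)] g(1)] fusion[OF that(1)] g(2)
      by simp
    show "le' (h t) g" if "omega_chain A le f" "is_sup A le f t" "\<And>i. le' (h (f i)) g" for f t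
    proof -
      have "is_sup A' le' (\<lambda>i. h (f i)) (h t)" using h that(1,2) unfolding omega_cont_def by blast
      then show ?thesis using that(3) g(1) unfolding is_sup_def by blast
    qed
  qed
  then show ?thesis
    using s fusion[OF s(1)] omega_cont_closed[OF h cpo] unfolding is_least_fixpoint_def by simp
qed

end

section \<open>Categories and functors\<close>

text \<open>Typing is checked by the simplifier, which computes sources and targets; hence the axioms
  are restated with side conditions on \<open>src\<close> and \<open>tgt\<close>.\<close>

lemma in_hom_iff [simp]: "f \<in> hom C X Y \<longleftrightarrow> f \<in> arrs C \<and> src C f = X \<and> tgt C f = Y"
  by (simp add: hom_def)

context category
begin

lemma idn_arr [simp]: "idn C X \<in> arrs C" "src C (idn C X) = X" "tgt C (idn C X) = X"
  using idn_hom[of X] by auto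

lemma cmp_arr [simp]:
  assumes "f \<in> arrs C" "g \<in> arrs C" "tgt C f = src C g"
  shows "g \<cdot> f \<in> arrs C" "src C (g \<cdot> f) = src C f" "tgt C (g \<cdot> f) = tgt C g"
  using cmp_hom[of f "src C f" "tgt C f" g "tgt C g"] assms by auto

lemma cmp_idn [simp]:
  "\<lbrakk>f \<in> arrs C; tgt C f = Y\<rbrakk> \<Longrightarrow> idn C Y \<cdot> f = f"
  "\<lbrakk>f \<in> arrs C; src C f = X\<rbrakk> \<Longrightarrow> f \<cdot> idn C X = f"
  using cmp_idn_left cmp_idn_right by auto

lemma cmp_cmp [simp]:
  "\<lbrakk>f \<in> arrs C; g \<in> arrs C; h \<in> arrs C; tgt C f = src C g; tgt C g = src C h\<rbrakk>
    \<Longrightarrow> (h \<cdot> g) \<cdot> f = h \<cdot> (g \<cdot> f)"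
  using cmp_assoc by auto

lemma cmp_eq_extend:
  "\<lbrakk>h \<cdot> g = k; f \<in> arrs C; g \<in> arrs C; h \<in> arrs C; tgt C f = src C g; tgt C g = src C h\<rbrakk>
    \<Longrightarrow> h \<cdot> (g \<cdot> f) = k \<cdot> f"
  by (metis cmp_cmp)

lemma inv_arr:
  assumes "is_iso C f"
  shows "inv_arr C f \<in> hom C (tgt C f) (src C f)"
    and "inv_arr C f \<cdot> f = idn C (src C f)" and "f \<cdot> inv_arr C f = idn C (tgt C f)"
proof -
  let ?P = "\<lambda>g. g \<in> hom C (tgt C f) (src C f) \<and> g \<cdot> f = idn C (src C f) \<and> f \<cdot> g = idn C (tgt C f)"
  have f: "f \<in> arrs C" using assms unfolding is_iso_def by blast
  have "g = h" if "?P g" "?P h" for g h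
  proof -
    have "g = g \<cdot> (f \<cdot> h)" using that by simp
    also have "\<dots> = (g \<cdot> f) \<cdot> h" using that f cmp_cmp[of h f g] by simp
    also have "\<dots> = h" using that by simp
    finally show ?thesis .
  qed
  moreover obtain g where "?P g" using assms unfolding is_iso_def by blast
  ultimately have "\<exists>!g. ?P g" by blast
  from theI'[OF this] have "?P (inv_arr C f)" unfolding inv_arr_def .
  then show "inv_arr C f \<in> hom C (tgt C f) (src C f)"
    "inv_arr C f \<cdot> f = idn C (src C f)" "f \<cdot> inv_arr C f = idn C (tgt C f)"
    by blast+
qed

lemma coproduct_eqI:
  assumes "is_coproduct C X Y P i j" "f \<in> hom C P Z" "g \<in> hom C P Z" "f \<cdot> i = g \<cdot> i" "f \<cdot> j = g \<cdot> j"
  shows "f = g"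
proof -
  have "i \<in> hom C X P" "j \<in> hom C Y P" using assms(1) unfolding is_coproduct_def by blast+
  then have "f \<cdot> i \<in> hom C X Z" "f \<cdot> j \<in> hom C Y Z" using assms(2) by simp_all
  then have "\<exists>!h. h \<in> hom C P Z \<and> h \<cdot> i = f \<cdot> i \<and> h \<cdot> j = f \<cdot> j"
    using assms(1) unfolding is_coproduct_def by blast
  then show ?thesis using assms(2-5) by metis
qed

lemma coproduct_iso:
  assumes P: "is_coproduct C X Y P i j" and u: "u \<in> hom C P Q" and w: "w \<in> hom C Q P"
    and inverse: "w \<cdot> u = idn C P" "u \<cdot> w = idn C Q"
  shows "is_coproduct C X Y Q (u \<cdot> i) (u \<cdot> j)"
  unfolding is_coproduct_def
proof (intro conjI allI ballI)
  have i: "i \<in> hom C X P" and j: "j \<in> hom C Y P" using P unfolding is_coproduct_def by blast+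
  then show "u \<cdot> i \<in> hom C X Q" "u \<cdot> j \<in> hom C Y Q" using u by simp_all
  fix Z f g
  assume "f \<in> hom C X Z" "g \<in> hom C Y Z"
  then obtain h where h: "h \<in> hom C P Z" "h \<cdot> i = f" "h \<cdot> j = g"
    using P unfolding is_coproduct_def by blast
  have w_u: "w \<cdot> (u \<cdot> k) = k" if "k \<in> hom C W P" for k W
    using cmp_eq_extend[OF inverse(1), of k] that u w by simp
  show "\<exists>!h. h \<in> hom C Q Z \<and> h \<cdot> (u \<cdot> i) = f \<and> h \<cdot> (u \<cdot> j) = g"
  proof
    show "h \<cdot> w \<in> hom C Q Z \<and> (h \<cdot> w) \<cdot> (u \<cdot> i) = f \<and> (h \<cdot> w) \<cdot> (u \<cdot> j) = g"
      using h u w i j w_u by simp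
    fix k
    assume k: "k \<in> hom C Q Z \<and> k \<cdot> (u \<cdot> i) = f \<and> k \<cdot> (u \<cdot> j) = g"
    have "k \<cdot> u = h"
      by (rule coproduct_eqI[OF P, of _ Z]) (use k h u i j in simp_all)
    then show "k = h \<cdot> w" using k u w inverse(2) by auto
  qed
qed

end

lemma functor_arr:
  assumes "is_functor A B F" "f \<in> arrs A"
  shows "amap F f \<in> arrs B" "src B (amap F f) = omap F (src A f)"
    "tgt B (amap F f) = omap F (tgt A f)"
proof -
  have "amap F f \<in> hom B (omap F (src A f)) (omap F (tgt A f))"
    using assms unfolding is_functor_def by (blast intro: in_hom_iff[THEN iffD2])
  then show "amap F f \<in> arrs B" "src B (amap F f) = omap F (src A f)"
    "tgt B (amap F f) = omap F (tgt A f)" by simp_all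
qed

lemma functor_idn: "is_functor A B F \<Longrightarrow> amap F (idn A X) = idn B (omap F X)"
  unfolding is_functor_def by blast

lemma functor_cmp:
  assumes "is_functor A B F" "f \<in> arrs A" "g \<in> arrs A" "tgt A f = src A g"
  shows "amap F (g \<cdot>\<^bsub>A\<^esub> f) = amap F g \<cdot>\<^bsub>B\<^esub> amap F f"
proof -
  have "f \<in> hom A (src A f) (src A g)" "g \<in> hom A (src A g) (tgt A g)" using assms by simp_all
  then show ?thesis using assms(1) unfolding is_functor_def by blast
qed

lemma prod_cat_simps [simp]:
  "(f, g) \<in> arrs (A \<times>\<^sub>C B) \<longleftrightarrow> f \<in> arrs A \<and> g \<in> arrs B"
  "src (A \<times>\<^sub>C B) (f, g) = (src A f, src B g)"
  "tgt (A \<times>\<^sub>C B) (f, g) = (tgt A f, tgt B g)"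
  "idn (A \<times>\<^sub>C B) (X, Y) = (idn A X, idn B Y)"
  "(f', g') \<cdot>\<^bsub>A \<times>\<^sub>C B\<^esub> (f, g) = (f' \<cdot>\<^bsub>A\<^esub> f, g' \<cdot>\<^bsub>B\<^esub> g)"
  by (simp_all add: prod_cat_def)

lemma op_cat_simps [simp]:
  "arrs (op_cat A) = arrs A" "src (op_cat A) = tgt A" "tgt (op_cat A) = src A"
  "g \<cdot>\<^bsub>op_cat A\<^esub> f = f \<cdot>\<^bsub>A\<^esub> g"
  by (simp_all add: op_cat_def)

locale endofunctor = category C
  for C :: "('o, 'm, 'x) cat_scheme" (structure) and S :: "('o, 'm, 'o, 'm, 'z) func_scheme" +
  assumes is_functor: "is_functor C C S"
begin

lemmas amap_arr [simp] = functor_arr[OF is_functor]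
lemmas amap_idn [simp] = functor_idn[OF is_functor]
lemmas amap_cmp = functor_cmp[OF is_functor]

definition alg_hom :: "'m \<Rightarrow> 'm \<Rightarrow> 'm set" where
  "alg_hom a b = {h \<in> hom C (tgt C a) (tgt C b). h \<cdot> a = b \<cdot> amap S h}"

lemma alg_hom_arr: "h \<in> alg_hom a b \<Longrightarrow> h \<in> hom C (tgt C a) (tgt C b)"
  and alg_hom_square: "h \<in> alg_hom a b \<Longrightarrow> h \<cdot> a = b \<cdot> amap S h"
  by (simp_all add: alg_hom_def)

lemma alg_hom_idn: "a \<in> hom C (omap S A) A \<Longrightarrow> idn C A \<in> alg_hom a a"
  by (simp add: alg_hom_def)

lemma alg_hom_cmp:
  assumes f: "f \<in> alg_hom a b" and g: "g \<in> alg_hom b c"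
    and a: "a \<in> hom C (omap S (tgt C a)) (tgt C a)" and b: "b \<in> hom C (omap S (tgt C b)) (tgt C b)"
    and c: "c \<in> hom C (omap S (tgt C c)) (tgt C c)"
  shows "g \<cdot> f \<in> alg_hom a c"
proof -
  have "g \<cdot> (f \<cdot> a) = (g \<cdot> b) \<cdot> amap S f"
    using alg_hom_arr[OF f] alg_hom_arr[OF g] b by (simp add: alg_hom_square[OF f])
  then show ?thesis
    using alg_hom_arr[OF f] alg_hom_arr[OF g] a b c
    by (simp add: alg_hom_def alg_hom_square[OF g] amap_cmp)
qed

end

locale bifunctor = category C
  for C :: "('o, 'm, 'x) cat_scheme" (structure) and P :: "('o \<times> 'o, 'm \<times> 'm, 'o, 'm) func" +
  assumes is_functor: "is_functor (C \<times>\<^sub>C C) C P"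
begin

lemmas amap_arr [simp] = functor_arr[OF is_functor, of "(f, g)" for f g, simplified]
lemmas amap_idn [simp] = functor_idn[OF is_functor, of "(X, Y)" for X Y, simplified]

lemma amap_amap:
  assumes "f \<in> arrs C" "g \<in> arrs C" "f' \<in> arrs C" "g' \<in> arrs C"
    "tgt C f = src C f'" "tgt C g = src C g'"
  shows "amap P (f', g') \<cdot> amap P (f, g) = amap P (f' \<cdot> f, g' \<cdot> g)"
    and "\<lbrakk>h \<in> arrs C; tgt C h = omap P (src C f, src C g)\<rbrakk>
      \<Longrightarrow> amap P (f', g') \<cdot> (amap P (f, g) \<cdot> h) = amap P (f' \<cdot> f, g' \<cdot> g) \<cdot> h"
proof -
  show merge: "amap P (f', g') \<cdot> amap P (f, g) = amap P (f' \<cdot> f, g' \<cdot> g)"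
    using functor_cmp[OF is_functor, of "(f, g)" "(f', g')"] assms by simp
  show "amap P (f', g') \<cdot> (amap P (f, g) \<cdot> h) = amap P (f' \<cdot> f, g' \<cdot> g) \<cdot> h"
    if "h \<in> arrs C" "tgt C h = omap P (src C f, src C g)"
    by (rule cmp_eq_extend[OF merge]) (use that assms in simp_all)
qed

end

section \<open>Products and coproducts\<close>

context distributive_category
begin

lemma prd_arr [simp]:
  "pfst C X Y \<in> arrs C" "src C (pfst C X Y) = X \<otimes> Y" "tgt C (pfst C X Y) = X"
  "psnd C X Y \<in> arrs C" "src C (psnd C X Y) = X \<otimes> Y" "tgt C (psnd C X Y) = Y"
  using pfst_hom[of X Y] psnd_hom[of X Y] by auto

lemma cop_arr [simp]:
  "cinl C X Y \<in> arrs C" "src C (cinl C X Y) = X" "tgt C (cinl C X Y) = X \<oplus> Y"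
  "cinr C X Y \<in> arrs C" "src C (cinr C X Y) = Y" "tgt C (cinr C X Y) = X \<oplus> Y"
  using cinl_hom[of X Y] cinr_hom[of X Y] by auto

lemma pair_arr [simp]:
  assumes "f \<in> arrs C" "g \<in> arrs C" "src C f = src C g"
  shows "\<langle>f, g\<rangle> \<in> arrs C" "src C \<langle>f, g\<rangle> = src C g" "tgt C \<langle>f, g\<rangle> = tgt C f \<otimes> tgt C g"
  using pair_hom[of f "src C g" "tgt C f" g "tgt C g"] assms by auto

lemma proj_pair [simp]:
  assumes "f \<in> arrs C" "g \<in> arrs C" "src C f = src C g" "tgt C f = X" "tgt C g = Y"
  shows "pfst C X Y \<cdot> \<langle>f, g\<rangle> = f" "psnd C X Y \<cdot> \<langle>f, g\<rangle> = g"
  using pfst_pair[of f "src C g" X g Y] psnd_pair[of f "src C g" X g Y] assms by auto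

lemma copair_arr [simp]:
  assumes "f \<in> arrs C" "g \<in> arrs C" "tgt C f = tgt C g"
  shows "\<lblot>f, g\<rblot> \<in> arrs C" "src C \<lblot>f, g\<rblot> = src C f \<oplus> src C g" "tgt C \<lblot>f, g\<rblot> = tgt C g"
  using copair_hom[of f "src C f" "tgt C g" g "src C g"] assms by auto

lemma copair_inj [simp]:
  assumes "f \<in> arrs C" "g \<in> arrs C" "tgt C f = tgt C g" "src C f = X" "src C g = Y"
  shows "\<lblot>f, g\<rblot> \<cdot> cinl C X Y = f" "\<lblot>f, g\<rblot> \<cdot> cinr C X Y = g"
    and "\<lbrakk>h \<in> arrs C; tgt C h = X\<rbrakk> \<Longrightarrow> \<lblot>f, g\<rblot> \<cdot> (cinl C X Y \<cdot> h) = f \<cdot> h"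
    and "\<lbrakk>h \<in> arrs C; tgt C h = Y\<rbrakk> \<Longrightarrow> \<lblot>f, g\<rblot> \<cdot> (cinr C X Y \<cdot> h) = g \<cdot> h"
proof -
  show inj: "\<lblot>f, g\<rblot> \<cdot> cinl C X Y = f" "\<lblot>f, g\<rblot> \<cdot> cinr C X Y = g"
    using copair_cinl[of f X "tgt C g" g Y] copair_cinr[of f X "tgt C g" g Y] assms by simp_all
  show "\<lblot>f, g\<rblot> \<cdot> (cinl C X Y \<cdot> h) = f \<cdot> h" if "h \<in> arrs C" "tgt C h = X"
    by (rule cmp_eq_extend[OF inj(1)]) (use that assms in simp_all)
  show "\<lblot>f, g\<rblot> \<cdot> (cinr C X Y \<cdot> h) = g \<cdot> h" if "h \<in> arrs C" "tgt C h = Y"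
    by (rule cmp_eq_extend[OF inj(2)]) (use that assms in simp_all)
qed

lemma pair_eqI:
  assumes "h \<in> hom C Z (X \<otimes> Y)" "k \<in> hom C Z (X \<otimes> Y)"
    "pfst C X Y \<cdot> h = pfst C X Y \<cdot> k" "psnd C X Y \<cdot> h = psnd C X Y \<cdot> k"
  shows "h = k"
  by (metis pair_unique[OF assms(1)] pair_unique[OF assms(2)] assms(3,4))

lemma copair_eqI:
  assumes "h \<in> hom C (X \<oplus> Y) Z" "k \<in> hom C (X \<oplus> Y) Z"
    "h \<cdot> cinl C X Y = k \<cdot> cinl C X Y" "h \<cdot> cinr C X Y = k \<cdot> cinr C X Y"
  shows "h = k"
  by (metis copair_unique[OF assms(1)] copair_unique[OF assms(2)] assms(3,4))

lemma pair_cmp: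
  assumes "f \<in> arrs C" "g \<in> arrs C" "src C f = src C g" "h \<in> arrs C" "tgt C h = src C g"
  shows "\<langle>f, g\<rangle> \<cdot> h = \<langle>f \<cdot> h, g \<cdot> h\<rangle>"
  by (rule pair_eqI[of _ "src C h" "tgt C f" "tgt C g"])
     (use assms in \<open>simp_all flip: cmp_cmp\<close>)

lemma cmp_copair:
  assumes "f \<in> arrs C" "g \<in> arrs C" "tgt C f = tgt C g" "h \<in> arrs C" "tgt C g = src C h"
  shows "h \<cdot> \<lblot>f, g\<rblot> = \<lblot>h \<cdot> f, h \<cdot> g\<rblot>"
  by (rule copair_eqI[of _ "src C f" "src C g" "tgt C h"]) (use assms in simp_all)

lemma pmap_arr [simp]:
  assumes "f \<in> arrs C" "g \<in> arrs C"
  shows "f \<otimes>\<^sub>m g \<in> arrs C" "src C (f \<otimes>\<^sub>m g) = src C f \<otimes> src C g"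
    "tgt C (f \<otimes>\<^sub>m g) = tgt C f \<otimes> tgt C g"
  using assms by (simp_all add: pmap_def)

lemma pmap_pair:
  assumes "f \<in> arrs C" "g \<in> arrs C" "h \<in> arrs C" "k \<in> arrs C"
    "src C h = src C k" "tgt C h = src C f" "tgt C k = src C g"
  shows "(f \<otimes>\<^sub>m g) \<cdot> \<langle>h, k\<rangle> = \<langle>f \<cdot> h, g \<cdot> k\<rangle>"
  using assms by (simp add: pmap_def pair_cmp)

lemma cmap_arr [simp]:
  assumes "f \<in> arrs C" "g \<in> arrs C"
  shows "f \<oplus>\<^sub>m g \<in> arrs C" "src C (f \<oplus>\<^sub>m g) = src C f \<oplus> src C g"
    "tgt C (f \<oplus>\<^sub>m g) = tgt C f \<oplus> tgt C g"
  using assms by (simp_all add: cmap_def)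

lemma cmap_inj [simp]:
  assumes "f \<in> arrs C" "g \<in> arrs C" "src C f = X" "src C g = Y"
  shows "(f \<oplus>\<^sub>m g) \<cdot> cinl C X Y = cinl C (tgt C f) (tgt C g) \<cdot> f"
    "(f \<oplus>\<^sub>m g) \<cdot> cinr C X Y = cinr C (tgt C f) (tgt C g) \<cdot> g"
    "\<lbrakk>h \<in> arrs C; tgt C h = X\<rbrakk> \<Longrightarrow>
      (f \<oplus>\<^sub>m g) \<cdot> (cinl C X Y \<cdot> h) = cinl C (tgt C f) (tgt C g) \<cdot> (f \<cdot> h)"
    "\<lbrakk>h \<in> arrs C; tgt C h = Y\<rbrakk> \<Longrightarrow>
      (f \<oplus>\<^sub>m g) \<cdot> (cinr C X Y \<cdot> h) = cinr C (tgt C f) (tgt C g) \<cdot> (g \<cdot> h)"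
  using assms by (simp_all add: cmap_def)

lemma copair_cmap:
  assumes "f \<in> arrs C" "g \<in> arrs C" "h \<in> arrs C" "k \<in> arrs C"
    "tgt C h = tgt C k" "tgt C f = src C h" "tgt C g = src C k"
  shows "\<lblot>h, k\<rblot> \<cdot> (f \<oplus>\<^sub>m g) = \<lblot>h \<cdot> f, k \<cdot> g\<rblot>"
  by (rule copair_eqI[of _ "src C f" "src C g" "tgt C k"]) (use assms in simp_all)

lemma cmap_cmap:
  assumes "f \<in> arrs C" "g \<in> arrs C" "h \<in> arrs C" "k \<in> arrs C"
    "tgt C f = src C h" "tgt C g = src C k"
  shows "(h \<oplus>\<^sub>m k) \<cdot> (f \<oplus>\<^sub>m g) = (h \<cdot> f) \<oplus>\<^sub>m (k \<cdot> g)"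
  by (rule copair_eqI[of _ "src C f" "src C g" "tgt C h \<oplus> tgt C k"]) (use assms in simp_all)

lemma cmap_idn: "idn C X \<oplus>\<^sub>m idn C Y = idn C (X \<oplus> Y)"
  by (rule copair_eqI[of _ X Y "X \<oplus> Y"]) simp_all

lemma codiagonal_cmap:
  assumes "f \<in> hom C X Y"
  shows "\<lblot>idn C Y, idn C Y\<rblot> \<cdot> (f \<oplus>\<^sub>m f) = f \<cdot> \<lblot>idn C X, idn C X\<rblot>"
  using assms by (simp add: copair_cmap cmp_copair)

lemma distributor_cmap_pair:
  assumes "f \<in> hom C U X" "v \<in> hom C U Y" "g \<in> hom C W X" "w \<in> hom C W Z"
  shows "\<lblot>idn C X \<otimes>\<^sub>m cinl C Y Z, idn C X \<otimes>\<^sub>m cinr C Y Z\<rblot> \<cdot> (\<langle>f, v\<rangle> \<oplus>\<^sub>m \<langle>g, w\<rangle>) = \<langle>\<lblot>f, g\<rblot>, v \<oplus>\<^sub>m w\<rangle>"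
  by (rule copair_eqI[of _ U W "X \<otimes> (Y \<oplus> Z)"]) (use assms in \<open>simp_all add: pair_cmp pmap_pair\<close>)

definition coproduct_comparison :: "'o \<Rightarrow> 'o \<Rightarrow> 'o \<Rightarrow> 'm \<Rightarrow> 'm \<Rightarrow> 'm" where
  "coproduct_comparison X Y P i j =
     (THE h. h \<in> hom C P (X \<oplus> Y) \<and> h \<cdot> i = cinl C X Y \<and> h \<cdot> j = cinr C X Y)"

lemma coproduct_comparison:
  assumes "is_coproduct C X Y P i j"
  shows "coproduct_comparison X Y P i j \<in> hom C P (X \<oplus> Y)"
    "coproduct_comparison X Y P i j \<cdot> i = cinl C X Y"
    "coproduct_comparison X Y P i j \<cdot> j = cinr C X Y"
proof -
  have "\<exists>!h. h \<in> hom C P (X \<oplus> Y) \<and> h \<cdot> i = cinl C X Y \<and> h \<cdot> j = cinr C X Y"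
    using assms cinl_hom cinr_hom unfolding is_coproduct_def by blast
  from theI'[OF this] show "coproduct_comparison X Y P i j \<in> hom C P (X \<oplus> Y)"
    "coproduct_comparison X Y P i j \<cdot> i = cinl C X Y"
    "coproduct_comparison X Y P i j \<cdot> j = cinr C X Y"
    unfolding coproduct_comparison_def by blast+
qed

end

section \<open>Initial and free algebras\<close>

locale initial_algebra = distributive_category C + S: endofunctor C S
  for C :: "('o, 'm) bicart" (structure) and S :: "('o, 'm, 'o, 'm) func" +
  fixes M :: 'o and \<alpha> :: 'm
  assumes structure_hom: "\<alpha> \<in> hom C (omap S M) M"
    and fold_ex1: "a \<in> hom C (omap S A) A \<Longrightarrow> \<exists>!h. h \<in> S.alg_hom \<alpha> a"
begin

lemma structure_arr [simp]: "\<alpha> \<in> arrs C" "src C \<alpha> = omap S M" "tgt C \<alpha> = M"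
  using structure_hom by auto

lemma lambek: "is_iso C \<alpha>"
proof -
  obtain h where h: "h \<in> S.alg_hom \<alpha> (amap S \<alpha>)"
    using fold_ex1[of "amap S \<alpha>" "omap S M"] by auto
  then have h_arr: "h \<in> hom C M (omap S M)" using S.alg_hom_arr by simp
  have "\<alpha> \<in> S.alg_hom (amap S \<alpha>) \<alpha>" by (simp add: S.alg_hom_def)
  then have "\<alpha> \<cdot> h \<in> S.alg_hom \<alpha> \<alpha>"
    by (rule S.alg_hom_cmp[OF h]) simp_all
  moreover have "idn C M \<in> S.alg_hom \<alpha> \<alpha>" by (rule S.alg_hom_idn) simp
  ultimately have section_h: "\<alpha> \<cdot> h = idn C M" using fold_ex1[OF structure_hom] by blast
  have "h \<cdot> \<alpha> = amap S (\<alpha> \<cdot> h)"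
    using h_arr by (simp add: S.alg_hom_square[OF h] S.amap_cmp)
  also have "\<dots> = idn C (omap S M)" unfolding section_h by simp
  finally show ?thesis
    unfolding is_iso_def using h_arr section_h by (intro conjI bexI[of _ h]) simp_all
qed

lemma pair_in_alg_hom_iff:
  assumes a: "a \<in> hom C (omap S (M \<otimes> A)) A" and h: "h \<in> hom C M A"
  shows "\<langle>idn C M, h\<rangle> \<in> S.alg_hom \<alpha> \<langle>\<alpha> \<cdot> amap S (pfst C M A), a\<rangle> \<longleftrightarrow> h \<cdot> \<alpha> = a \<cdot> amap S \<langle>idn C M, h\<rangle>"
proof -
  let ?p = "\<langle>idn C M, h\<rangle>" and ?a = "\<langle>\<alpha> \<cdot> amap S (pfst C M A), a\<rangle>"
  have "amap S (pfst C M A) \<cdot> amap S ?p = idn C (omap S M)"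
    using h by (simp flip: S.amap_cmp)
  then have "?a \<cdot> amap S ?p = \<langle>\<alpha>, a \<cdot> amap S ?p\<rangle>" and "?p \<cdot> \<alpha> = \<langle>\<alpha>, h \<cdot> \<alpha>\<rangle>"
    using a h by (simp_all add: pair_cmp)
  moreover have "\<langle>\<alpha>, f\<rangle> = \<langle>\<alpha>, g\<rangle> \<longleftrightarrow> f = g"
    if "f \<in> hom C (omap S M) A" "g \<in> hom C (omap S M) A" for f g
  proof
    assume "\<langle>\<alpha>, f\<rangle> = \<langle>\<alpha>, g\<rangle>"
    then have "psnd C M A \<cdot> \<langle>\<alpha>, f\<rangle> = psnd C M A \<cdot> \<langle>\<alpha>, g\<rangle>" by simp
    then show "f = g" using that by simp
  qed simp
  ultimately show ?thesis using a h by (simp add: S.alg_hom_def)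
qed

theorem primitive_recursion_ex1:
  assumes a: "a \<in> hom C (omap S (M \<otimes> A)) A"
  shows "\<exists>!h. h \<in> hom C M A \<and> h \<cdot> \<alpha> = a \<cdot> amap S \<langle>idn C M, h\<rangle>"
proof -
  let ?a = "\<langle>\<alpha> \<cdot> amap S (pfst C M A), a\<rangle>"
  have "?a \<in> hom C (omap S (M \<otimes> A)) (M \<otimes> A)" using a by simp
  then obtain p where p: "p \<in> S.alg_hom \<alpha> ?a" and unique: "\<And>q. q \<in> S.alg_hom \<alpha> ?a \<Longrightarrow> q = p"
    using fold_ex1 by blast
  have p_arr: "p \<in> hom C M (M \<otimes> A)" using S.alg_hom_arr[OF p] a by simp
  have "pfst C M A \<in> S.alg_hom ?a \<alpha>" using a by (simp add: S.alg_hom_def)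
  then have "pfst C M A \<cdot> p \<in> S.alg_hom \<alpha> \<alpha>"
    by (rule S.alg_hom_cmp[OF p]) (use a in simp_all)
  moreover have "idn C M \<in> S.alg_hom \<alpha> \<alpha>" by (rule S.alg_hom_idn) simp
  ultimately have "pfst C M A \<cdot> p = idn C M" using fold_ex1[OF structure_hom] by blast
  then have p_eq: "\<langle>idn C M, psnd C M A \<cdot> p\<rangle> = p" using pair_unique[OF p_arr] by simp
  show ?thesis
  proof
    show "psnd C M A \<cdot> p \<in> hom C M A \<and>
        (psnd C M A \<cdot> p) \<cdot> \<alpha> = a \<cdot> amap S \<langle>idn C M, psnd C M A \<cdot> p\<rangle>"
      using p p_arr pair_in_alg_hom_iff[OF a, of "psnd C M A \<cdot> p"] unfolding p_eq by simp
    fix h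
    assume h: "h \<in> hom C M A \<and> h \<cdot> \<alpha> = a \<cdot> amap S \<langle>idn C M, h\<rangle>"
    then have "\<langle>idn C M, h\<rangle> = p" using pair_in_alg_hom_iff[OF a] unique by blast
    then show "h = psnd C M A \<cdot> p" using h by auto
  qed
qed

end

locale free_algebra_category = distributive_category C + S: endofunctor C S
  for C :: "('o, 'm) bicart" (structure) and S :: "('o, 'm, 'o, 'm) func" +
  fixes F :: "('o, 'm) free_algs"
  assumes free: "free_algebras C S F"
begin

abbreviation "free_map f \<equiv> amap (free_functor C S F) f"

lemma free_arr [simp]:
  "funit F X \<in> arrs C" "src C (funit F X) = X" "tgt C (funit F X) = fobj F X"
  "falg F X \<in> arrs C" "src C (falg F X) = omap S (fobj F X)" "tgt C (falg F X) = fobj F X"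
  using free unfolding free_algebras_def by auto

lemma is_free_ext_iff:
  "a \<in> hom C (omap S A) A \<Longrightarrow>
    is_free_ext C S F X A a f h \<longleftrightarrow> h \<in> S.alg_hom (falg F X) a \<and> h \<cdot> funit F X = f"
  unfolding is_free_ext_def S.alg_hom_def by auto

lemma free_ext_ex1:
  "\<lbrakk>a \<in> hom C (omap S A) A; f \<in> hom C X A\<rbrakk> \<Longrightarrow> \<exists>!h. is_free_ext C S F X A a f h"
  using free unfolding free_algebras_def by blast

lemma free_alg_hom_eqI:
  assumes "a \<in> hom C (omap S A) A" "h \<in> S.alg_hom (falg F X) a" "k \<in> S.alg_hom (falg F X) a"
    "h \<cdot> funit F X = k \<cdot> funit F X"
  shows "h = k"
proof -
  have "h \<cdot> funit F X \<in> hom C X A" using S.alg_hom_arr[OF assms(2)] assms(1) by simp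
  from free_ext_ex1[OF assms(1) this] show ?thesis
    using assms(2-4) unfolding is_free_ext_iff[OF assms(1)] by metis
qed

lemma free_map_alg_hom:
    "f \<in> hom C X Y \<Longrightarrow> free_map f \<in> S.alg_hom (falg F X) (falg F Y)"
  and free_map_funit:
    "f \<in> hom C X Y \<Longrightarrow> free_map f \<cdot> funit F X = funit F Y \<cdot> f"
proof -
  assume f: "f \<in> hom C X Y"
  then have "\<exists>!h. is_free_ext C S F X (fobj F Y) (falg F Y) (funit F Y \<cdot> f) h"
    by (intro free_ext_ex1) simp_all
  from theI'[OF this] have "is_free_ext C S F X (fobj F Y) (falg F Y) (funit F Y \<cdot> f) (free_map f)"
    using f by (simp add: free_functor_def)
  then show "free_map f \<in> S.alg_hom (falg F X) (falg F Y)" "free_map f \<cdot> funit F X = funit F Y \<cdot> f"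
    by (simp_all add: is_free_ext_iff)
qed

lemma free_map_arr [simp]:
  "f \<in> arrs C \<Longrightarrow> free_map f \<in> arrs C"
  "f \<in> arrs C \<Longrightarrow> src C (free_map f) = fobj F (src C f)"
  "f \<in> arrs C \<Longrightarrow> tgt C (free_map f) = fobj F (tgt C f)"
  using S.alg_hom_arr[OF free_map_alg_hom, of f] by simp_all

lemma free_mult_alg_hom: "free_mult C S F X \<in> S.alg_hom (falg F (fobj F X)) (falg F X)"
  and free_mult_funit: "free_mult C S F X \<cdot> funit F (fobj F X) = idn C (fobj F X)"
proof -
  have "\<exists>!h. is_free_ext C S F (fobj F X) (fobj F X) (falg F X) (idn C (fobj F X)) h"
    by (intro free_ext_ex1) simp_all
  from theI'[OF this] show "free_mult C S F X \<in> S.alg_hom (falg F (fobj F X)) (falg F X)"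
    "free_mult C S F X \<cdot> funit F (fobj F X) = idn C (fobj F X)"
    by (simp_all add: free_mult_def is_free_ext_iff)
qed

lemma free_mult_arr [simp]:
  "free_mult C S F X \<in> arrs C" "src C (free_mult C S F X) = fobj F (fobj F X)"
  "tgt C (free_mult C S F X) = fobj F X"
  using S.alg_hom_arr[OF free_mult_alg_hom[of X]] by simp_all

lemma free_map_free_map:
  assumes "f \<in> hom C X Y" "g \<in> hom C Y Z"
  shows "free_map g \<cdot> free_map f = free_map (g \<cdot> f)"
proof (rule free_alg_hom_eqI)
  show "free_map g \<cdot> free_map f \<in> S.alg_hom (falg F X) (falg F Z)"
    by (rule S.alg_hom_cmp[OF free_map_alg_hom[OF assms(1)] free_map_alg_hom[OF assms(2)]]) simp_all
  show "free_map (g \<cdot> f) \<in> S.alg_hom (falg F X) (falg F Z)"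
    using assms by (intro free_map_alg_hom) simp
  show "(free_map g \<cdot> free_map f) \<cdot> funit F X = free_map (g \<cdot> f) \<cdot> funit F X"
    using assms cmp_eq_extend[OF free_map_funit[OF assms(2)], of f]
    by (simp add: free_map_funit[where Y = Y] free_map_funit[where Y = Z])
qed simp

lemma alg_hom_free_mult:
  assumes h: "h \<in> S.alg_hom (falg F X) (falg F Y)"
  shows "h \<cdot> free_mult C S F X = free_mult C S F Y \<cdot> free_map h"
proof (rule free_alg_hom_eqI)
  have h_arr: "h \<in> hom C (fobj F X) (fobj F Y)" using S.alg_hom_arr[OF h] by simp
  show "h \<cdot> free_mult C S F X \<in> S.alg_hom (falg F (fobj F X)) (falg F Y)"
    by (rule S.alg_hom_cmp[OF free_mult_alg_hom h]) simp_all
  show "free_mult C S F Y \<cdot> free_map h \<in> S.alg_hom (falg F (fobj F X)) (falg F Y)"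
    by (rule S.alg_hom_cmp[OF free_map_alg_hom[OF h_arr] free_mult_alg_hom]) simp_all
  show "(h \<cdot> free_mult C S F X) \<cdot> funit F (fobj F X)
      = (free_mult C S F Y \<cdot> free_map h) \<cdot> funit F (fobj F X)"
    using h_arr cmp_eq_extend[OF free_mult_funit, of h Y]
    by (simp add: free_mult_funit free_map_funit[OF h_arr])
qed simp

lemma initial_algebra_free_zero: "initial_algebra C S (fobj F (zero C)) (falg F (zero C))"
proof
  fix a A
  assume a: "a \<in> hom C (omap S A) A"
  obtain f where f: "f \<in> hom C (zero C) A" and f_unique: "\<And>g. g \<in> hom C (zero C) A \<Longrightarrow> g = f"
    using initial by blast
  have "is_free_ext C S F (zero C) A a f h \<longleftrightarrow> h \<in> S.alg_hom (falg F (zero C)) a" for h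
  proof -
    have "h \<cdot> funit F (zero C) = f" if "h \<in> S.alg_hom (falg F (zero C)) a"
      using S.alg_hom_arr[OF that] a by (intro f_unique) simp
    then show ?thesis using is_free_ext_iff[OF a] by blast
  qed
  then show "\<exists>!h. h \<in> S.alg_hom (falg F (zero C)) a" using free_ext_ex1[OF a f] by simp
qed simp

end

section \<open>Kleisli calculus\<close>

locale distributive_strong_monad = distributive_category C + strong_monad C T
  for C :: "('o, 'm) bicart" (structure) and T :: "('o, 'm) smonad"
begin

sublocale T: endofunctor C T
  by unfold_locales (rule functor_T)

lemma monad_arr [simp]:
  "munit T X \<in> arrs C" "src C (munit T X) = X" "tgt C (munit T X) = omap T X"
  "mmult T X \<in> arrs C" "src C (mmult T X) = omap T (omap T X)" "tgt C (mmult T X) = omap T X"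
  "mstr T X Y \<in> arrs C" "src C (mstr T X Y) = X \<otimes> omap T Y" "tgt C (mstr T X Y) = omap T (X \<otimes> Y)"
  using munit_hom[of X] mmult_hom[of X] mstr_hom[of X Y] by auto

lemma amap_munit:
  assumes "f \<in> arrs C" "src C f = X"
  shows "amap T f \<cdot> munit T X = munit T (tgt C f) \<cdot> f"
    and "\<lbrakk>h \<in> arrs C; tgt C h = X\<rbrakk> \<Longrightarrow> amap T f \<cdot> (munit T X \<cdot> h) = munit T (tgt C f) \<cdot> (f \<cdot> h)"
proof -
  show natural: "amap T f \<cdot> munit T X = munit T (tgt C f) \<cdot> f"
    using munit_natural[of f X "tgt C f"] assms by simp
  show "amap T f \<cdot> (munit T X \<cdot> h) = munit T (tgt C f) \<cdot> (f \<cdot> h)" if "h \<in> arrs C" "tgt C h = X"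
    using cmp_eq_extend[OF natural, of h] that assms by simp
qed

abbreviation "lift Z f \<equiv> klift C T Z f"

lemma lift_arr [simp]:
  assumes "f \<in> arrs C" "tgt C f = omap T Z"
  shows "lift Z f \<in> arrs C" "src C (lift Z f) = omap T (src C f)" "tgt C (lift Z f) = omap T Z"
  using assms by (simp_all add: klift_def)

lemma lift_munit [simp]: "lift Z (munit T Z) = idn C (omap T Z)"
  by (simp add: klift_def mmult_map_munit)

lemma lift_cmp_munit [simp]:
  assumes "f \<in> arrs C" "tgt C f = omap T Z" "src C f = X"
  shows "lift Z f \<cdot> munit T X = f"
    and "\<lbrakk>h \<in> arrs C; tgt C h = X\<rbrakk> \<Longrightarrow> lift Z f \<cdot> (munit T X \<cdot> h) = f \<cdot> h"
proof -
  show unit: "lift Z f \<cdot> munit T X = f"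
    using assms amap_munit[of f X] cmp_eq_extend[OF mmult_munit, of f Z] by (simp add: klift_def)
  show "lift Z f \<cdot> (munit T X \<cdot> h) = f \<cdot> h" if "h \<in> arrs C" "tgt C h = X"
    by (rule cmp_eq_extend[OF unit]) (use that assms in simp_all)
qed

lemma lift_amap:
  assumes "f \<in> arrs C" "tgt C f = omap T Z" "g \<in> arrs C" "tgt C g = src C f"
  shows "lift Z f \<cdot> amap T g = lift Z (f \<cdot> g)"
  using assms by (simp add: klift_def T.amap_cmp)

lemma amap_eq_lift: "f \<in> hom C X Y \<Longrightarrow> amap T f = lift Y (munit T Y \<cdot> f)"
  using lift_amap[of "munit T Y" Y f] by simp

lemma lift_lift:
  assumes f: "f \<in> hom C Y (omap T Z)" and g: "g \<in> hom C X (omap T Y)"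
  shows "lift Z f \<cdot> lift Y g = lift Z (lift Z f \<cdot> g)"
proof -
  have "lift Z f \<cdot> lift Y g = mmult T Z \<cdot> (amap T f \<cdot> mmult T Y) \<cdot> amap T g"
    using f g by (simp add: klift_def)
  also have "\<dots> = (mmult T Z \<cdot> mmult T (omap T Z)) \<cdot> amap T (amap T f) \<cdot> amap T g"
    using f g mmult_natural[OF f] by simp
  also have "\<dots> = lift Z (lift Z f \<cdot> g)"
    using f g by (simp add: mmult_mmult klift_def T.amap_cmp)
  finally show ?thesis .
qed

lemma amap_lift:
  assumes "f \<in> hom C Y Z" "g \<in> hom C X (omap T Y)"
  shows "amap T f \<cdot> lift Y g = lift Z (amap T f \<cdot> g)"
  using assms lift_lift[of "munit T Z \<cdot> f" Y Z g X] by (simp add: amap_eq_lift[OF assms(1)])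

lemma strength_munit_pair:
  assumes f: "f \<in> hom C Z X" and g: "g \<in> hom C Z Y"
  shows "amap T (pfst C X Y) \<cdot> mstr T X Y \<cdot> \<langle>f, munit T Y \<cdot> g\<rangle> = munit T X \<cdot> f"
proof -
  have "\<langle>f, munit T Y \<cdot> g\<rangle> = (idn C X \<otimes>\<^sub>m munit T Y) \<cdot> \<langle>f, g\<rangle>"
    using f g by (simp add: pmap_pair)
  then have "mstr T X Y \<cdot> \<langle>f, munit T Y \<cdot> g\<rangle> = munit T (X \<otimes> Y) \<cdot> \<langle>f, g\<rangle>"
    using f g cmp_eq_extend[OF mstr_munit, of "\<langle>f, g\<rangle>" X Y] by simp
  then show ?thesis using f g by (simp add: amap_munit)
qed

lemma ksum_arr [simp]:
  assumes "f \<in> arrs C" "tgt C f = omap T X" "g \<in> arrs C" "tgt C g = omap T Y"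
  shows "ksum C T X Y f g \<in> arrs C" "src C (ksum C T X Y f g) = src C f \<oplus> src C g"
    "tgt C (ksum C T X Y f g) = omap T (X \<oplus> Y)"
  using assms by (simp_all add: ksum_def)

lemma ksum_cmap:
  assumes "f \<in> hom C W (omap T X)" "g \<in> hom C Z (omap T Y)" "h \<in> hom C U W" "k \<in> hom C U' Z"
  shows "ksum C T X Y f g \<cdot> (h \<oplus>\<^sub>m k) = ksum C T X Y (f \<cdot> h) (g \<cdot> k)"
  using assms by (simp add: ksum_def copair_cmap)

lemma codiagonal_ksum:
  assumes "f \<in> hom C U (omap T X)" "g \<in> hom C W (omap T X)"
  shows "amap T \<lblot>idn C X, idn C X\<rblot> \<cdot> ksum C T X X f g = \<lblot>f, g\<rblot>"
proof -
  let ?fold = "\<lblot>idn C X, idn C X\<rblot>"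
  have cancel: "amap T ?fold \<cdot> (amap T i \<cdot> h) = h"
    if "?fold \<cdot> i = idn C X" "i \<in> hom C X (X \<oplus> X)" "h \<in> hom C Z (omap T X)" for i h Z
  proof -
    have "amap T ?fold \<cdot> amap T i = idn C (omap T X)" using that by (simp flip: T.amap_cmp)
    from cmp_eq_extend[OF this, of h] show ?thesis using that by simp
  qed
  then show ?thesis using assms cancel[of "cinl C X X" f U] cancel[of "cinr C X X" g W]
    by (simp add: ksum_def cmp_copair)
qed

end

section \<open>The order on Kleisli hom-sets\<close>

locale distributive_omega_monad = distributive_strong_monad C T + omega_continuous_monad C T le
  for C :: "('o, 'm) bicart" (structure) and T :: "('o, 'm) smonad" and le
begin

lemma le_refl: "f \<in> hom C X (omap T Y) \<Longrightarrow> le X Y f f"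
  using omega_cpo_refl[OF hom_omega_cpo] .

lemma le_lift_right:
  "\<lbrakk>le X Y f f'; f \<in> hom C X (omap T Y); f' \<in> hom C X (omap T Y); g \<in> hom C Y (omap T Z)\<rbrakk>
    \<Longrightarrow> le X Z (lift Z g \<cdot> f) (lift Z g \<cdot> f')"
  using omega_cont_mono[OF klift_cont_left hom_omega_cpo] .

lemma le_lift_left:
  "\<lbrakk>le Y Z g g'; g \<in> hom C Y (omap T Z); g' \<in> hom C Y (omap T Z); f \<in> hom C X (omap T Y)\<rbrakk>
    \<Longrightarrow> le X Z (lift Z g \<cdot> f) (lift Z g' \<cdot> f)"
  using omega_cont_mono[OF klift_cont_right hom_omega_cpo] .

lemma precomp_cont:
  assumes f: "f \<in> hom C X Y"
  shows "omega_cont (hom C Y (omap T Z)) (le Y Z) (hom C X (omap T Z)) (le X Z) (\<lambda>g. g \<cdot> f)"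
proof (rule omega_cont_cong)
  show "omega_cont (hom C Y (omap T Z)) (le Y Z) (hom C X (omap T Z)) (le X Z)
      (\<lambda>g. lift Z g \<cdot> (munit T Y \<cdot> f))"
    using f by (intro klift_cont_right) simp
  show "lift Z g \<cdot> (munit T Y \<cdot> f) = g \<cdot> f" if "g \<in> hom C Y (omap T Z)" for g
    using f that by simp
qed

lemma le_precomp:
  "\<lbrakk>le Y Z g g'; g \<in> hom C Y (omap T Z); g' \<in> hom C Y (omap T Z); f \<in> hom C X Y\<rbrakk>
    \<Longrightarrow> le X Z (g \<cdot> f) (g' \<cdot> f)"
  using omega_cont_mono[OF precomp_cont hom_omega_cpo] .

lemma copair_right_cont:
  assumes "f \<in> hom C X (omap T Z)"
  shows "omega_cont (hom C Y (omap T Z)) (le Y Z) (hom C (X \<oplus> Y) (omap T Z)) (le (X \<oplus> Y) Z)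
    (\<lambda>g. \<lblot>f, g\<rblot>)"
  unfolding omega_cont_def
proof (intro allI impI)
  fix gs t
  assume "omega_chain (hom C Y (omap T Z)) (le Y Z) gs" "is_sup (hom C Y (omap T Z)) (le Y Z) gs t"
  then show "is_sup (hom C (X \<oplus> Y) (omap T Z)) (le (X \<oplus> Y) Z) (\<lambda>i. \<lblot>f, gs i\<rblot>) \<lblot>f, t\<rblot>"
    by (rule copair_cont[OF omega_chain_const[OF hom_omega_cpo assms]
          is_sup_const[OF hom_omega_cpo assms]])
qed

lemma le_copair:
  assumes "le X Z f f'" "le Y Z g g'" "f \<in> hom C X (omap T Z)" "f' \<in> hom C X (omap T Z)"
    "g \<in> hom C Y (omap T Z)" "g' \<in> hom C Y (omap T Z)"
  shows "le (X \<oplus> Y) Z \<lblot>f, g\<rblot> \<lblot>f', g'\<rblot>"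
proof -
  let ?two = "\<lambda>x y n. if n = (0::nat) then x else y"
  have "is_sup (hom C (X \<oplus> Y) (omap T Z)) (le (X \<oplus> Y) Z) (\<lambda>n. \<lblot>?two f f' n, ?two g g' n\<rblot>) \<lblot>f', g'\<rblot>"
    using assms by (intro copair_cont omega_chain_two is_sup_two hom_omega_cpo)
  then have "le (X \<oplus> Y) Z \<lblot>?two f f' 0, ?two g g' 0\<rblot> \<lblot>f', g'\<rblot>" unfolding is_sup_def by blast
  then show ?thesis by simp
qed

lemma le_coproductI:
  assumes cop: "is_coproduct C X Y P i j"
    and f: "f \<in> hom C P (omap T Z)" and g: "g \<in> hom C P (omap T Z)"
    and "le X Z (f \<cdot> i) (g \<cdot> i)" "le Y Z (f \<cdot> j) (g \<cdot> j)"
  shows "le P Z f g"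
proof -
  let ?h = "coproduct_comparison X Y P i j"
  note h = coproduct_comparison[OF cop]
  have i: "i \<in> hom C X P" and j: "j \<in> hom C Y P" using cop unfolding is_coproduct_def by auto
  have split: "\<lblot>k \<cdot> i, k \<cdot> j\<rblot> \<cdot> ?h = k" if "k \<in> hom C P (omap T Z)" for k
    by (rule coproduct_eqI[OF cop, of _ "omap T Z"]) (use that h i j in simp_all)
  have "le P Z (\<lblot>f \<cdot> i, f \<cdot> j\<rblot> \<cdot> ?h) (\<lblot>g \<cdot> i, g \<cdot> j\<rblot> \<cdot> ?h)"
    using assms i j h by (intro le_precomp[OF le_copair]) simp_all
  then show ?thesis using split f g by simp
qed

lemma amap_cinl_bot_le_munit:
  assumes b: "is_bot (hom C Y (omap T X)) (le Y X) b"
  shows "le (X \<oplus> Y) (X \<oplus> Y) (amap T (cinl C X Y) \<cdot> \<lblot>munit T X, b\<rblot>) (munit T (X \<oplus> Y))"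
proof -
  let ?\<eta> = "munit T (X \<oplus> Y)" and ?inl = "cinl C X Y" and ?inr = "cinr C X Y"
  have b_arr: "b \<in> hom C Y (omap T X)" using b unfolding is_bot_def by blast
  have "amap T ?inl \<cdot> b = lift (X \<oplus> Y) (?\<eta> \<cdot> ?inl) \<cdot> b"
    by (simp add: amap_eq_lift[of ?inl X "X \<oplus> Y"])
  then have "is_bot (hom C Y (omap T (X \<oplus> Y))) (le Y (X \<oplus> Y)) (amap T ?inl \<cdot> b)"
    using klift_bot[OF _ b, of "?\<eta> \<cdot> ?inl" "X \<oplus> Y"] by simp
  then have "le Y (X \<oplus> Y) (amap T ?inl \<cdot> b) (?\<eta> \<cdot> ?inr)" unfolding is_bot_def by simp
  then have "le (X \<oplus> Y) (X \<oplus> Y) \<lblot>?\<eta> \<cdot> ?inl, amap T ?inl \<cdot> b\<rblot> \<lblot>?\<eta> \<cdot> ?inl, ?\<eta> \<cdot> ?inr\<rblot>"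
    using b_arr by (intro le_copair le_refl) simp_all
  moreover have "\<lblot>?\<eta> \<cdot> ?inl, ?\<eta> \<cdot> ?inr\<rblot> = ?\<eta>"
    by (rule copair_eqI[of _ X Y "omap T (X \<oplus> Y)"]) simp_all
  ultimately show ?thesis using b_arr by (simp add: cmp_copair amap_munit)
qed

end

section \<open>Distributive laws in the active argument\<close>

locale monad_distributive_law = distributive_strong_monad C T + Sc: bifunctor C Sc
  for C :: "('o, 'm) bicart" (structure) and T :: "('o, 'm) smonad"
    and Sc :: "('o \<times> 'o, 'm \<times> 'm, 'o, 'm) func" +
  fixes \<chi> :: "'o \<Rightarrow> 'o \<Rightarrow> 'm"
  assumes dist_hom: "\<chi> X Y \<in> hom C (omap Sc (omap T X, Y)) (omap T (omap Sc (X, Y)))"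
    and dist_natural: "\<lbrakk>f \<in> hom C X X'; g \<in> hom C Y Y'\<rbrakk> \<Longrightarrow>
      amap T (amap Sc (f, g)) \<cdot> \<chi> X Y = \<chi> X' Y' \<cdot> amap Sc (amap T f, g)"
    and dist_munit: "\<chi> X Y \<cdot> amap Sc (munit T X, idn C Y) = munit T (omap Sc (X, Y))"
    and dist_mmult: "\<chi> X Y \<cdot> amap Sc (mmult T X, idn C Y) =
      mmult T (omap Sc (X, Y)) \<cdot> amap T (\<chi> X Y) \<cdot> \<chi> (omap T X) Y"
begin

lemma dist_arr [simp]:
  "\<chi> X Y \<in> arrs C" "src C (\<chi> X Y) = omap Sc (omap T X, Y)" "tgt C (\<chi> X Y) = omap T (omap Sc (X, Y))"
  using dist_hom[of X Y] by auto

lemma dist_lift: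
  assumes f: "f \<in> hom C W (omap T Y)" and g: "g \<in> hom C U (omap T W)"
  shows "lift (omap Sc (Y, Z)) (\<chi> Y Z \<cdot> amap Sc (f, idn C Z)) \<cdot> \<chi> W Z \<cdot> amap Sc (g, idn C Z)
    = \<chi> Y Z \<cdot> amap Sc (lift Y f \<cdot> g, idn C Z)"
proof -
  have "lift (omap Sc (Y, Z)) (\<chi> Y Z \<cdot> amap Sc (f, idn C Z)) \<cdot> \<chi> W Z \<cdot> amap Sc (g, idn C Z)
    = mmult T (omap Sc (Y, Z)) \<cdot> amap T (\<chi> Y Z) \<cdot> (amap T (amap Sc (f, idn C Z)) \<cdot> \<chi> W Z)
      \<cdot> amap Sc (g, idn C Z)"
    using f g by (simp add: klift_def T.amap_cmp)
  also have "\<dots> = (mmult T (omap Sc (Y, Z)) \<cdot> amap T (\<chi> Y Z) \<cdot> \<chi> (omap T Y) Z)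
      \<cdot> amap Sc (amap T f \<cdot> g, idn C Z)"
    using f g dist_natural[OF f, of "idn C Z" Z Z] by (simp add: Sc.amap_amap)
  also have "\<dots> = \<chi> Y Z \<cdot> amap Sc (lift Y f \<cdot> g, idn C Z)"
    unfolding dist_mmult[symmetric] using f g by (simp add: Sc.amap_amap klift_def)
  finally show ?thesis .
qed

lemma dist_amap:
  assumes f: "f \<in> hom C X Y" and g: "g \<in> hom C U (omap T X)"
  shows "\<chi> Y Z \<cdot> amap Sc (amap T f \<cdot> g, idn C Z)
    = amap T (amap Sc (f, idn C Z)) \<cdot> \<chi> X Z \<cdot> amap Sc (g, idn C Z)"
proof -
  have "\<chi> Y Z \<cdot> amap Sc (amap T f \<cdot> g, idn C Z)
      = (\<chi> Y Z \<cdot> amap Sc (amap T f, idn C Z)) \<cdot> amap Sc (g, idn C Z)"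
    using f g by (simp add: Sc.amap_amap)
  also have "\<chi> Y Z \<cdot> amap Sc (amap T f, idn C Z) = amap T (amap Sc (f, idn C Z)) \<cdot> \<chi> X Z"
    using dist_natural[OF f, of "idn C Z" Z Z] by simp
  finally show ?thesis using f g by simp
qed

end

context computation_splitting
begin

lemma \<theta>_arr [simp]:
  "\<theta> X Y Z \<in> arrs C" "src C (\<theta> X Y Z) = omap \<Theta> (X, Y, Z)" "tgt C (\<theta> X Y Z) = omap Sc (X \<oplus> Y, Z)"
  using coproduct[of X Z Y] unfolding is_coproduct_def by simp_all

lemmas \<Theta>_arr [simp] = functor_arr[OF functor_\<Theta>, of "(f, g, h)" for f g h, simplified]

end

locale continuous_split_law = monad_distributive_law C T Sc \<chi> + distributive_omega_monad C T le +
  computation_splitting C Sc \<Theta> \<theta>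
  for C :: "('o, 'm) bicart" (structure) and T Sc \<chi> le \<Theta> \<theta> +
  assumes dist_cont:
    "omega_cont (hom C X (omap T Y)) (le X Y)
      (hom C (omap Sc (X, Z)) (omap T (omap Sc (Y, Z)))) (le (omap Sc (X, Z)) (omap Sc (Y, Z)))
      (\<lambda>f. \<chi> Y Z \<cdot> amap Sc (f, idn C Z))"
begin

lemma le_dist:
  "\<lbrakk>le X Y f g; f \<in> hom C X (omap T Y); g \<in> hom C X (omap T Y)\<rbrakk> \<Longrightarrow>
    le (omap Sc (X, Z)) (omap Sc (Y, Z))
      (\<chi> Y Z \<cdot> amap Sc (f, idn C Z)) (\<chi> Y Z \<cdot> amap Sc (g, idn C Z))"
  using omega_cont_mono[OF dist_cont hom_omega_cpo] .

text \<open>Since \<open>\<lblot>\<eta>, \<bottom>\<rblot>\<close> lies below the unit of \<open>X \<oplus> Y\<close>, monotonicity of \<open>\<chi>\<close> puts its image on the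
  summand \<open>\<Theta>\<close> below \<open>\<eta> \<cdot> \<theta>\<close>; a map out of the coproduct can be chosen freely on that summand.\<close>

lemma dist_copair_bot:
  assumes b: "is_bot (hom C Y (omap T X)) (le Y X) b"
  shows "is_bot (hom C (omap \<Theta> (X, Y, Z)) (omap T (omap Sc (X, Z))))
    (le (omap \<Theta> (X, Y, Z)) (omap Sc (X, Z)))
    (\<chi> X Z \<cdot> amap Sc (\<lblot>munit T X, b\<rblot>, idn C Z) \<cdot> \<theta> X Y Z)"
    (is "is_bot (hom C ?Q (omap T ?R)) _ ?bot")
  unfolding is_bot_def
proof
  let ?P = "X \<oplus> Y" and ?i = "cinl C X Y" and ?k = "\<lblot>munit T X, b\<rblot>"
  have b_arr: "b \<in> hom C Y (omap T X)" using b unfolding is_bot_def by blast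
  then show "?bot \<in> hom C ?Q (omap T ?R)" by simp
  show "\<forall>q \<in> hom C ?Q (omap T ?R). le ?Q ?R ?bot q"
  proof
    fix q
    assume "q \<in> hom C ?Q (omap T ?R)"
    then obtain f where f: "f \<in> hom C (omap Sc (?P, Z)) (omap T ?R)"
        "f \<cdot> amap Sc (?i, idn C Z) = munit T ?R" "f \<cdot> \<theta> X Y Z = q"
      using coproduct[of X Z Y] munit_hom[of ?R] unfolding is_coproduct_def by blast
    let ?out = "\<lambda>g. lift ?R f \<cdot> (\<chi> ?P Z \<cdot> amap Sc (g, idn C Z)) \<cdot> \<theta> X Y Z"
    have "le ?Q ?R (?out (amap T ?i \<cdot> ?k)) (?out (munit T ?P))"
      using b_arr f(1)
      by (intro le_lift_right[OF le_precomp[OF le_dist[OF amap_cinl_bot_le_munit[OF b]]]]) simp_all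
    moreover have "?out (munit T ?P) = q"
      unfolding dist_munit using f(1,3) by simp
    moreover have "?out (amap T ?i \<cdot> ?k) = (lift ?R f \<cdot> amap T (amap Sc (?i, idn C Z))) \<cdot> ?bot"
      using b_arr f(1) by (simp add: dist_amap[of ?i X])
    moreover have "lift ?R f \<cdot> amap T (amap Sc (?i, idn C Z)) = idn C (omap T ?R)"
      using f(1,2) by (simp add: lift_amap)
    ultimately show "le ?Q ?R ?bot q" using b_arr by simp
  qed
qed

end

section \<open>The signature and its initial algebra\<close>

locale hogsos_syntax = distributive_category C + hogsos C Sv Sc F T D \<rho>v \<rho>c \<chi> +
  Sv: endofunctor C Sv + Sc: bifunctor C Sc
  for C :: "('o, 'm) bicart" (structure) and Sv Sc F T D \<rho>v \<rho>c \<chi> +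
  assumes functor_D: "is_functor (op_cat C \<times>\<^sub>C C) C D"
    and free_signature: "free_algebras C S F"
begin

lemmas D_arr [simp] = functor_arr[OF functor_D, of "(f, g)" for f g, simplified]

lemma D_amap_amap:
  assumes "f \<in> arrs C" "g \<in> arrs C" "f' \<in> arrs C" "g' \<in> arrs C"
    "tgt C f' = src C f" "tgt C g = src C g'"
  shows "Da f' g' \<cdot> Da f g = Da (f \<cdot> f') (g' \<cdot> g)"
    and "\<lbrakk>h \<in> arrs C; tgt C h = Do (tgt C f) (src C g)\<rbrakk>
      \<Longrightarrow> Da f' g' \<cdot> (Da f g \<cdot> h) = Da (f \<cdot> f') (g' \<cdot> g) \<cdot> h"
proof -
  show merge: "Da f' g' \<cdot> Da f g = Da (f \<cdot> f') (g' \<cdot> g)"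
    using functor_cmp[OF functor_D, of "(f, g)" "(f', g')"] assms by simp
  show "Da f' g' \<cdot> (Da f g \<cdot> h) = Da (f \<cdot> f') (g' \<cdot> g) \<cdot> h"
    if "h \<in> arrs C" "tgt C h = Do (tgt C f) (src C g)"
    by (rule cmp_eq_extend[OF merge]) (use that assms in simp_all)
qed

lemma S_simps: "omap S X = Svo X \<oplus> Sco X X" "amap S f = Sva f \<oplus>\<^sub>m Sca f f"
  by (simp_all add: sig_functor_def)

lemma is_functor_S: "is_functor C C S"
  unfolding is_functor_def
  by (auto simp: S_simps cmap_idn cmap_cmap Sv.amap_cmp Sc.amap_amap)

sublocale free_algebra_category C S F
  by unfold_locales (fact is_functor_S free_signature)+

sublocale initial_algebra C S mu iota
  unfolding mu_def iota_def by (rule initial_algebra_free_zero)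

lemma mu_simps [simp]: "Fo (zero C) = mu" "Svo mu = V" "Sco mu mu = K" "omap S mu = V \<oplus> K"
  by (simp_all add: mu_def V_def K_def S_simps)

abbreviation "iota_inv \<equiv> inv_arr C iota"
abbreviation "\<iota>v \<equiv> iota_v (zero C)"
abbreviation "\<iota>c \<equiv> iota_c (zero C)"

lemma iota_summand_arr [simp]:
  "iota_v X \<in> arrs C" "src C (iota_v X) = Svo (Fo X)" "tgt C (iota_v X) = Fo X"
  "iota_c X \<in> arrs C" "src C (iota_c X) = Sco (Fo X) (Fo X)" "tgt C (iota_c X) = Fo X"
  by (simp_all add: iota_v_def iota_c_def S_simps)

lemma alg_hom_iota_summand:
  assumes h: "h \<in> S.alg_hom (falg F X) (falg F Y)"
  shows "h \<cdot> iota_v X = iota_v Y \<cdot> Sva h" "h \<cdot> iota_c X = iota_c Y \<cdot> Sca h h"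
  using S.alg_hom_arr[OF h] cmp_eq_extend[OF S.alg_hom_square[OF h]]
  by (simp_all add: iota_v_def iota_c_def S_simps)

lemma iota_inj [simp]: "iota \<cdot> cinl C V K = \<iota>v" "iota \<cdot> cinr C V K = \<iota>c"
  by (simp_all add: iota_v_def iota_c_def iota_def)

lemma iota_inv_arr [simp]:
  "iota_inv \<in> arrs C" "src C iota_inv = mu" "tgt C iota_inv = V \<oplus> K"
  and iota_inv_iota [simp]: "iota_inv \<cdot> iota = idn C (V \<oplus> K)" "iota \<cdot> iota_inv = idn C mu"
  using inv_arr[OF lambek] by auto

lemma iota_inv_iota_summand [simp]: "iota_inv \<cdot> \<iota>v = cinl C V K" "iota_inv \<cdot> \<iota>c = cinr C V K"
  using cmp_eq_extend[OF iota_inv_iota(1), of "cinl C V K"]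
    cmp_eq_extend[OF iota_inv_iota(1), of "cinr C V K"] by simp_all

lemma copair_iota_summand: "\<lblot>\<iota>v, \<iota>c\<rblot> = iota"
  by (rule copair_eqI[of _ V K mu]) simp_all

lemma cmp_iota: "f \<in> hom C mu Z \<Longrightarrow> f \<cdot> iota = \<lblot>f \<cdot> \<iota>v, f \<cdot> \<iota>c\<rblot>"
  by (simp add: cmp_copair flip: copair_iota_summand)

lemma mu_eqI:
  assumes "f \<in> hom C mu Z" "g \<in> hom C mu Z" "f \<cdot> \<iota>v = g \<cdot> \<iota>v" "f \<cdot> \<iota>c = g \<cdot> \<iota>c"
  shows "f = g"
proof -
  have "(f \<cdot> iota) \<cdot> iota_inv = (g \<cdot> iota) \<cdot> iota_inv"
    using assms by (simp only: cmp_iota)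
  then show ?thesis using assms by simp
qed

lemma computation_fold_eqI:
  assumes w: "w \<in> hom C V A" and n: "n \<in> hom C (Sco A mu) A"
    and h: "h \<in> hom C mu A" "h \<cdot> \<iota>v = w" "h \<cdot> \<iota>c = n \<cdot> Sca h (idn C mu)"
    and k: "k \<in> hom C mu A" "k \<cdot> \<iota>v = w" "k \<cdot> \<iota>c = n \<cdot> Sca k (idn C mu)"
  shows "h = k"
proof -
  let ?fst = "pfst C mu A"
  let ?a = "\<lblot>w \<cdot> Sva ?fst, n \<cdot> Sca (psnd C mu A) ?fst\<rblot>"
  have a: "?a \<in> hom C (omap S (mu \<otimes> A)) A" using w n by (simp add: S_simps)
  have step: "h \<cdot> iota = ?a \<cdot> amap S \<langle>idn C mu, h\<rangle>"
    if h: "h \<in> hom C mu A" "h \<cdot> \<iota>v = w" "h \<cdot> \<iota>c = n \<cdot> Sca h (idn C mu)" for h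
    unfolding cmp_iota[OF h(1)] using h w n
    by (simp add: S_simps copair_cmap Sc.amap_amap flip: Sv.amap_cmp)
  show ?thesis using primitive_recursion_ex1[OF a] step[OF h] step[OF k] h(1) k(1) by blast
qed

text \<open>The map \<open>\<langle>iota, w \<oplus>\<^sub>m g\<rangle>\<close> pairs the active argument of a computation with the result obtained
  recursively for it.\<close>

lemma computation_recursion_ex1:
  assumes w: "w \<in> hom C V W" and n: "n \<in> hom C (Sco (mu \<otimes> (W \<oplus> A)) mu) A"
  shows "\<exists>!g. g \<in> hom C K A \<and> g \<cdot> Sca iota (idn C mu) = n \<cdot> Sca \<langle>iota, w \<oplus>\<^sub>m g\<rangle> (idn C mu)"
proof -
  let ?B = "W \<oplus> A"
  let ?a = "(w \<cdot> Sva (pfst C mu ?B)) \<oplus>\<^sub>m (n \<cdot> Sca (idn C (mu \<otimes> ?B)) (pfst C mu ?B))"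
  let ?comp = "\<lambda>h. n \<cdot> Sca \<langle>idn C mu, h\<rangle> (idn C mu)"
  have a: "?a \<in> hom C (omap S (mu \<otimes> ?B)) ?B" using w n by (simp add: S_simps)
  have a_pair: "?a \<cdot> amap S \<langle>idn C mu, h\<rangle> = w \<oplus>\<^sub>m ?comp h" if "h \<in> hom C mu ?B" for h
    using that w n by (simp add: S_simps cmap_cmap Sc.amap_amap flip: Sv.amap_cmp)
  obtain h where h: "h \<in> hom C mu ?B" "h \<cdot> iota = w \<oplus>\<^sub>m ?comp h"
    and unique: "\<And>k. \<lbrakk>k \<in> hom C mu ?B; k \<cdot> iota = w \<oplus>\<^sub>m ?comp k\<rbrakk> \<Longrightarrow> k = h"
    using primitive_recursion_ex1[OF a] a_pair by metis
  show ?thesis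
  proof (rule ex1I[of _ "?comp h"])
    show "?comp h \<in> hom C K A \<and>
        ?comp h \<cdot> Sca iota (idn C mu) = n \<cdot> Sca \<langle>iota, w \<oplus>\<^sub>m ?comp h\<rangle> (idn C mu)"
      using h(1) n by (simp add: Sc.amap_amap pair_cmp h(2)[symmetric])
    fix g
    assume g: "g \<in> hom C K A \<and> g \<cdot> Sca iota (idn C mu) = n \<cdot> Sca \<langle>iota, w \<oplus>\<^sub>m g\<rangle> (idn C mu)"
    let ?k = "(w \<oplus>\<^sub>m g) \<cdot> iota_inv"
    have "?comp ?k = (n \<cdot> Sca \<langle>iota, w \<oplus>\<^sub>m g\<rangle> (idn C mu)) \<cdot> Sca iota_inv (idn C mu)"
      using g w n by (simp add: Sc.amap_amap pair_cmp)
    also have "\<dots> = (g \<cdot> Sca iota (idn C mu)) \<cdot> Sca iota_inv (idn C mu)" using g by simp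
    also have "\<dots> = g" using conjunct1[OF g] by (simp add: Sc.amap_amap)
    finally have comp_k: "?comp ?k = g" .
    then have "?k = h" using g w by (intro unique) simp_all
    then show "g = ?comp h" using comp_k by simp
  qed
qed

lemma nabla_sharp_arr [simp]:
  "nabla_sharp X \<in> arrs C" "src C (nabla_sharp X) = Fo (Fo X \<oplus> Fo X)" "tgt C (nabla_sharp X) = Fo X"
  by (simp_all add: nabla_sharp_def)

lemma nabla_sharp_alg_hom: "nabla_sharp X \<in> S.alg_hom (falg F (Fo X \<oplus> Fo X)) (falg F X)"
  unfolding nabla_sharp_def
  by (rule S.alg_hom_cmp[OF free_map_alg_hom[of _ _ "Fo X"] free_mult_alg_hom]) simp_all

lemma nabla_sharp_funit:
  "nabla_sharp X \<cdot> funit F (Fo X \<oplus> Fo X) = \<lblot>idn C (Fo X), idn C (Fo X)\<rblot>"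
  using cmp_eq_extend[OF free_mult_funit, of "\<lblot>idn C (Fo X), idn C (Fo X)\<rblot>" X]
  by (simp add: nabla_sharp_def free_map_funit[where Y = "Fo X"])

lemma alg_hom_nabla_sharp:
  assumes h: "h \<in> S.alg_hom (falg F X) (falg F Y)"
  shows "h \<cdot> nabla_sharp X = nabla_sharp Y \<cdot> Fa (h \<oplus>\<^sub>m h)"
proof -
  have h_arr: "h \<in> hom C (Fo X) (Fo Y)" using S.alg_hom_arr[OF h] by simp
  let ?fold = "\<lambda>X. \<lblot>idn C (Fo X), idn C (Fo X)\<rblot>"
  have "h \<cdot> nabla_sharp X = (h \<cdot> Fmult X) \<cdot> Fa (?fold X)"
    using h_arr by (simp add: nabla_sharp_def)
  also have "\<dots> = Fmult Y \<cdot> (Fa h \<cdot> Fa (?fold X))"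
    unfolding alg_hom_free_mult[OF h] using h_arr by simp
  also have "Fa h \<cdot> Fa (?fold X) = Fa (?fold Y) \<cdot> Fa (h \<oplus>\<^sub>m h)"
    using h_arr codiagonal_cmap[OF h_arr] by (simp add: free_map_free_map)
  finally show ?thesis using h_arr by (simp add: nabla_sharp_def)
qed

lemma nabla_sharp_iota_c:
  "nabla_sharp X \<cdot> iota_c (Fo X \<oplus> Fo X) \<cdot> Sca (funit F (Fo X \<oplus> Fo X)) (funit F (Fo X \<oplus> Fo X)) =
   iota_c X \<cdot> Sca \<lblot>idn C (Fo X), idn C (Fo X)\<rblot> \<lblot>idn C (Fo X), idn C (Fo X)\<rblot>"
  using cmp_eq_extend[OF alg_hom_iota_summand(2)[OF nabla_sharp_alg_hom],
      of "Sca (funit F (Fo X \<oplus> Fo X)) (funit F (Fo X \<oplus> Fo X))" X]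
  by (simp add: Sc.amap_amap nabla_sharp_funit)

end

section \<open>The operational model\<close>

locale separated_model = hogsos_syntax C Sv Sc F T D \<rho>v \<rho>c \<chi> + distributive_strong_monad C T +
  separated_law C Sv Sc F T D \<rho>v \<rho>c \<chi>
  for C :: "('o, 'm) bicart" (structure) and Sv Sc F T D \<rho>v \<rho>c \<chi>
begin

sublocale monad_distributive_law C T Sc \<chi>
  by unfold_locales (fact \<chi>_hom \<chi>_natural \<chi>_munit \<chi>_mmult)+

lemma B_simps [simp]: "Bo X Y = To (Do X Y) \<oplus> To Y" "Ba f g = Ta (Da f g) \<oplus>\<^sub>m Ta g"
  by (simp_all add: B_def)

lemma law_arr [simp]:
  "\<rho>v X \<in> arrs C" "src C (\<rho>v X) = Svo X" "tgt C (\<rho>v X) = Do X (Fo X)"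
  "\<rho>c X Y \<in> arrs C" "src C (\<rho>c X Y) = Sco (X \<otimes> (To (Do X Y) \<oplus> To Y)) X"
  "tgt C (\<rho>c X Y) = To (Fo (X \<oplus> Y))"
  using \<rho>v_hom[of X] \<rho>c_hom[of X Y] by auto

lemma rho_cv_arr [simp]:
  "rho_cv X Y \<in> arrs C" "src C (rho_cv X Y) = Sco (X \<otimes> To (Do X Y)) X"
  "tgt C (rho_cv X Y) = To (Fo (X \<oplus> Y))"
  by (simp_all add: rho_cv_def)

lemma rho_cv_pair:
  assumes "u \<in> hom C U X" "d \<in> hom C U (To (Do X Y))" "k \<in> hom C W X"
  shows "rho_cv X Y \<cdot> Sca \<langle>u, d\<rangle> k = \<rho>c X Y \<cdot> Sca \<langle>u, cinl C (To (Do X Y)) (To Y) \<cdot> d\<rangle> k"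
  using assms by (simp add: rho_cv_def Sc.amap_amap pmap_pair)

text \<open>Naturality in the second argument and dinaturality in the first, combined along one map \<open>h\<close>.\<close>

lemma rho_cv_related:
  assumes h: "h \<in> hom C X X'" and u: "u \<in> hom C U X" and k: "k \<in> hom C W X"
    and d: "d \<in> hom C U (To (Do X X))" and d': "d' \<in> hom C U (To (Do X' X'))"
    and related: "Ta (Da (idn C X) h) \<cdot> d = Ta (Da h (idn C X')) \<cdot> d'"
  shows "Ta (Fa (h \<oplus>\<^sub>m h)) \<cdot> rho_cv X X \<cdot> Sca \<langle>u, d\<rangle> k = rho_cv X' X' \<cdot> Sca \<langle>h \<cdot> u, d'\<rangle> (h \<cdot> k)"
proof -
  let ?inl = "cinl C (To (Do X X)) (To X)" and ?inl' = "cinl C (To (Do X' X')) (To X')"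
  have "h \<oplus>\<^sub>m h = (h \<oplus>\<^sub>m idn C X') \<cdot> (idn C X \<oplus>\<^sub>m h)" using h by (simp add: cmap_cmap)
  then have "Ta (Fa (h \<oplus>\<^sub>m h)) = Ta (Fa (h \<oplus>\<^sub>m idn C X')) \<cdot> Ta (Fa (idn C X \<oplus>\<^sub>m h))"
    using h by (simp add: free_map_free_map flip: T.amap_cmp)
  then have "Ta (Fa (h \<oplus>\<^sub>m h)) \<cdot> rho_cv X X \<cdot> Sca \<langle>u, d\<rangle> k
      = Ta (Fa (h \<oplus>\<^sub>m idn C X')) \<cdot> (Ta (Fa (idn C X \<oplus>\<^sub>m h)) \<cdot> \<rho>c X X) \<cdot> Sca \<langle>u, ?inl \<cdot> d\<rangle> k"
    using h u k d by (simp add: rho_cv_pair[OF u d k])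
  also have "Ta (Fa (idn C X \<oplus>\<^sub>m h)) \<cdot> \<rho>c X X
      = \<rho>c X X' \<cdot> Sca (idn C X \<otimes>\<^sub>m Ba (idn C X) h) (idn C X)"
    by (rule \<rho>c_natural[OF h])
  also have "Ta (Fa (h \<oplus>\<^sub>m idn C X'))
        \<cdot> (\<rho>c X X' \<cdot> Sca (idn C X \<otimes>\<^sub>m Ba (idn C X) h) (idn C X)) \<cdot> Sca \<langle>u, ?inl \<cdot> d\<rangle> k
      = (Ta (Fa (h \<oplus>\<^sub>m idn C X')) \<cdot> \<rho>c X X' \<cdot> Sca (idn C X \<otimes>\<^sub>m Ba h (idn C X')) (idn C X))
        \<cdot> Sca \<langle>u, ?inl' \<cdot> d'\<rangle> k"
    using h u k d d' related by (simp add: Sc.amap_amap pmap_pair)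
  also have "\<dots> = (\<rho>c X' X' \<cdot> Sca (h \<otimes>\<^sub>m idn C (Bo X' X')) h) \<cdot> Sca \<langle>u, ?inl' \<cdot> d'\<rangle> k"
    unfolding \<rho>c_dinatural[OF h] ..
  also have "\<dots> = rho_cv X' X' \<cdot> Sca \<langle>h \<cdot> u, d'\<rangle> (h \<cdot> k)"
    using h u k d' rho_cv_pair[of "h \<cdot> u" U X' d' X' "h \<cdot> k" W]
    by (simp add: Sc.amap_amap pmap_pair)
  finally show ?thesis .
qed

definition value_behaviour :: "'o \<Rightarrow> 'm" where
  "value_behaviour X = munit T (Do (Fo X) (Fo X)) \<cdot> Da (idn C (Fo X)) (Fmult X) \<cdot> \<rho>v (Fo X)"

definition redex_step :: "'o \<Rightarrow> 'm" where
  "redex_step X = Ta (nabla_sharp X) \<cdot> rho_cv (Fo X) (Fo X)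
     \<cdot> Sca \<langle>iota_v X, value_behaviour X\<rangle> (idn C (Fo X))"

lemma value_behaviour_arr [simp]:
  "value_behaviour X \<in> arrs C" "src C (value_behaviour X) = Svo (Fo X)"
  "tgt C (value_behaviour X) = To (Do (Fo X) (Fo X))"
  by (simp_all add: value_behaviour_def)

lemma redex_step_arr [simp]:
  "redex_step X \<in> arrs C" "src C (redex_step X) = Sco (Svo (Fo X)) (Fo X)"
  "tgt C (redex_step X) = To (Fo X)"
  by (simp_all add: redex_step_def)

lemma gamma_v_eq: "gamma_v = value_behaviour (zero C)"
  by (simp add: gamma_v_def value_behaviour_def)

lemma xi_eq: "xi X = redex_step X \<cdot> Sca (Sva (funit F X)) (funit F X)"
  by (simp add: xi_def redex_step_def value_behaviour_def)

lemma value_behaviour_dinatural: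
  assumes h: "h \<in> S.alg_hom (falg F X) (falg F Y)"
  shows "Ta (Da (idn C (Fo X)) h) \<cdot> value_behaviour X
    = Ta (Da h (idn C (Fo Y))) \<cdot> value_behaviour Y \<cdot> Sva h"
proof -
  let ?X = "Fo X" and ?Y = "Fo Y"
  let ?\<eta> = "munit T (Do ?X ?Y)"
  have h_arr: "h \<in> hom C ?X ?Y" using S.alg_hom_arr[OF h] by simp
  have "Ta (Da (idn C ?X) h) \<cdot> value_behaviour X = ?\<eta> \<cdot> Da (idn C ?X) (h \<cdot> Fmult X) \<cdot> \<rho>v ?X"
    using h_arr by (simp add: value_behaviour_def amap_munit D_amap_amap)
  also have "\<dots> = ?\<eta> \<cdot> Da (idn C ?X) (Fmult Y) \<cdot> (Da (idn C ?X) (Fa h) \<cdot> \<rho>v ?X)"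
    unfolding alg_hom_free_mult[OF h] using h_arr by (simp add: D_amap_amap)
  also have "\<dots> = ?\<eta> \<cdot> Da (idn C ?X) (Fmult Y) \<cdot> (Da h (idn C (Fo ?Y)) \<cdot> \<rho>v ?Y \<cdot> Sva h)"
    unfolding \<rho>v_dinatural[OF h_arr] ..
  also have "\<dots> = Ta (Da h (idn C ?Y)) \<cdot> value_behaviour Y \<cdot> Sva h"
    using h_arr by (simp add: value_behaviour_def amap_munit D_amap_amap)
  finally show ?thesis .
qed

lemma redex_step_natural:
  assumes h: "h \<in> S.alg_hom (falg F X) (falg F Y)"
  shows "Ta h \<cdot> redex_step X = redex_step Y \<cdot> Sca (Sva h) h"
proof -
  have h_arr: "h \<in> hom C (Fo X) (Fo Y)" using S.alg_hom_arr[OF h] by simp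
  have "Ta h \<cdot> redex_step X = Ta (h \<cdot> nabla_sharp X) \<cdot> rho_cv (Fo X) (Fo X)
      \<cdot> Sca \<langle>iota_v X, value_behaviour X\<rangle> (idn C (Fo X))"
    using h_arr by (simp add: redex_step_def T.amap_cmp)
  also have "\<dots> = Ta (nabla_sharp Y) \<cdot> (Ta (Fa (h \<oplus>\<^sub>m h)) \<cdot> rho_cv (Fo X) (Fo X)
      \<cdot> Sca \<langle>iota_v X, value_behaviour X\<rangle> (idn C (Fo X)))"
    unfolding alg_hom_nabla_sharp[OF h] using h_arr by (simp add: T.amap_cmp)
  also have "Ta (Fa (h \<oplus>\<^sub>m h)) \<cdot> rho_cv (Fo X) (Fo X)
        \<cdot> Sca \<langle>iota_v X, value_behaviour X\<rangle> (idn C (Fo X))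
      = rho_cv (Fo Y) (Fo Y) \<cdot> Sca \<langle>h \<cdot> iota_v X, value_behaviour Y \<cdot> Sva h\<rangle> (h \<cdot> idn C (Fo X))"
    using h_arr value_behaviour_dinatural[OF h]
    by (intro rho_cv_related[where U = "Svo (Fo X)"]) simp_all
  also have "\<dots> = rho_cv (Fo Y) (Fo Y) \<cdot> Sca \<langle>iota_v Y, value_behaviour Y\<rangle> (idn C (Fo Y))
      \<cdot> Sca (Sva h) h"
    using h_arr alg_hom_iota_summand(1)[OF h] by (simp add: Sc.amap_amap pair_cmp)
  finally show ?thesis using h_arr by (simp add: redex_step_def)
qed

lemma free_mult_xi: "Ta (Fmult X) \<cdot> xi (Fo X) = redex_step X"
proof -
  let ?\<eta> = "funit F (Fo X)"
  have "Ta (Fmult X) \<cdot> xi (Fo X) = (Ta (Fmult X) \<cdot> redex_step (Fo X)) \<cdot> Sca (Sva ?\<eta>) ?\<eta>"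
    by (simp add: xi_eq)
  also have "\<dots> = redex_step X \<cdot> Sca (Sva (Fmult X \<cdot> ?\<eta>)) (Fmult X \<cdot> ?\<eta>)"
    unfolding redex_step_natural[OF free_mult_alg_hom] by (simp add: Sc.amap_amap Sv.amap_cmp)
  finally show ?thesis by (simp add: free_mult_funit)
qed

lemma gamma_c_ex1:
  "\<exists>!g. g \<in> hom C K (To mu) \<and> g \<cdot> Sca iota (idn C mu) =
     Ta (nabla_sharp (zero C)) \<cdot> \<rho>c mu mu \<cdot> Sca \<langle>iota, gamma_v \<oplus>\<^sub>m g\<rangle> (idn C mu)"
  using computation_recursion_ex1[of gamma_v "To (Do mu mu)"
      "Ta (nabla_sharp (zero C)) \<cdot> \<rho>c mu mu" "To mu"]
  by (simp add: gamma_v_eq cong: conj_cong)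

lemma gamma_c_arr [simp]: "gamma_c \<in> arrs C" "src C gamma_c = K" "tgt C gamma_c = To mu"
  and gamma_c_iota: "gamma_c \<cdot> Sca iota (idn C mu) =
     Ta (nabla_sharp (zero C)) \<cdot> \<rho>c mu mu \<cdot> Sca \<langle>iota, gamma_v \<oplus>\<^sub>m gamma_c\<rangle> (idn C mu)"
  using theI'[OF gamma_c_ex1] unfolding gamma_c_def[symmetric] by auto

definition redex_inj :: "'m" where
  "redex_inj = Sca \<iota>v (idn C mu)"

lemma redex_inj_arr [simp]: "redex_inj \<in> arrs C" "src C redex_inj = Sco V mu" "tgt C redex_inj = K"
  by (simp_all add: redex_inj_def)

lemma gamma_c_redex: "gamma_c \<cdot> redex_inj = redex_step (zero C)"
proof -
  have "gamma_c \<cdot> redex_inj = (gamma_c \<cdot> Sca iota (idn C mu)) \<cdot> Sca (cinl C V K) (idn C mu)"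
    by (simp add: redex_inj_def Sc.amap_amap)
  then show ?thesis
    unfolding gamma_c_iota
    by (simp add: redex_step_def rho_cv_pair[where U = V and W = mu] gamma_v_eq
        Sc.amap_amap pair_cmp)
qed

definition total_step :: "'m" where
  "total_step = \<lblot>munit T mu \<cdot> \<iota>v, gamma_c\<rblot> \<cdot> iota_inv"

definition context_step :: "'m" where
  "context_step = \<chi> mu mu \<cdot> Sca total_step (idn C mu)"

lemma total_step_arr [simp]:
  "total_step \<in> arrs C" "src C total_step = mu" "tgt C total_step = To mu"
  by (simp_all add: total_step_def)

lemma total_step_iota [simp]: "total_step \<cdot> \<iota>v = munit T mu \<cdot> \<iota>v" "total_step \<cdot> \<iota>c = gamma_c"
  by (simp_all add: total_step_def)

lemma context_step_arr [simp]:
  "context_step \<in> arrs C" "src C context_step = K" "tgt C context_step = To K"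
  by (simp_all add: context_step_def)

end

locale strongly_separated_model = separated_model C Sv Sc F T D \<rho>v \<rho>c \<chi> +
  computation_splitting C Sc \<Theta> \<theta>
  for C :: "('o, 'm) bicart" (structure) and Sv Sc F T D \<rho>v \<rho>c \<chi> \<Theta> \<theta> +
  assumes separated: "strongly_separated \<theta>"
begin

abbreviation "Context \<equiv> omap \<Theta> (V, K, mu)"

definition context_inj :: "'m" where
  "context_inj = Sca iota (idn C mu) \<cdot> \<theta> V K mu"

lemma context_inj_arr [simp]:
  "context_inj \<in> arrs C" "src C context_inj = Context" "tgt C context_inj = K"
  by (simp_all add: context_inj_def)

lemma coproduct_K: "is_coproduct C (Sco V mu) Context K redex_inj context_inj"
proof -
  have "is_coproduct C (Sco V mu) Context K
      (Sca iota (idn C mu) \<cdot> Sca (cinl C V K) (idn C mu)) (Sca iota (idn C mu) \<cdot> \<theta> V K mu)"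
    by (rule coproduct_iso[OF coproduct, where w = "Sca iota_inv (idn C mu)"])
       (simp_all add: Sc.amap_amap)
  then show ?thesis by (simp add: redex_inj_def context_inj_def Sc.amap_amap)
qed

lemma strongly_separated_pair:
  assumes u: "u \<in> hom C U X" and d: "d \<in> hom C U (To (Do X Y))"
    and k: "k \<in> hom C W X" and t: "t \<in> hom C W (To Y)"
  shows "\<rho>c X Y \<cdot> Sca \<langle>\<lblot>u, k\<rblot>, d \<oplus>\<^sub>m t\<rangle> (idn C X) \<cdot> \<theta> U W X
    = Ta (iota_c (X \<oplus> Y) \<cdot> Sca (funit F (X \<oplus> Y)) (funit F (X \<oplus> Y))) \<cdot> \<chi> (X \<oplus> Y) (X \<oplus> Y)
      \<cdot> Sca (ksum C T X Y (Ta (pfst C X (Do X Y)) \<cdot> mstr T X (Do X Y) \<cdot> \<langle>u, d\<rangle>) t) (cinl C X Y)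
      \<cdot> \<theta> U W X"
proof -
  let ?P = "X \<otimes> To (Do X Y)" and ?Q = "X \<otimes> To Y" and ?p = "\<langle>u, d\<rangle>" and ?q = "\<langle>k, t\<rangle>"
  let ?\<delta> = "\<lblot>idn C X \<otimes>\<^sub>m cinl C (To (Do X Y)) (To Y), idn C X \<otimes>\<^sub>m cinr C (To (Do X Y)) (To Y)\<rblot>"
  let ?\<sigma> = "ksum C T X Y (Ta (pfst C X (Do X Y)) \<cdot> mstr T X (Do X Y)) (psnd C X (To Y))"
  let ?\<iota> = "Ta (iota_c (X \<oplus> Y) \<cdot> Sca (funit F (X \<oplus> Y)) (funit F (X \<oplus> Y))) \<cdot> \<chi> (X \<oplus> Y) (X \<oplus> Y)"
  have natural: "Sca (?p \<oplus>\<^sub>m ?q) (idn C X) \<cdot> \<theta> U W X = \<theta> ?P ?Q X \<cdot> amap \<Theta> (?p, ?q, idn C X)"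
    using u d k t by (intro \<theta>_natural) simp_all
  have "\<rho>c X Y \<cdot> Sca \<langle>\<lblot>u, k\<rblot>, d \<oplus>\<^sub>m t\<rangle> (idn C X) \<cdot> \<theta> U W X
      = \<rho>c X Y \<cdot> Sca ?\<delta> (idn C X) \<cdot> (Sca (?p \<oplus>\<^sub>m ?q) (idn C X) \<cdot> \<theta> U W X)"
    using u d k t by (simp add: distributor_cmap_pair[OF u d k t, symmetric] Sc.amap_amap)
  also have "\<dots> = (\<rho>c X Y \<cdot> Sca ?\<delta> (idn C X) \<cdot> \<theta> ?P ?Q X) \<cdot> amap \<Theta> (?p, ?q, idn C X)"
    unfolding natural using u d k t by simp
  also have "\<rho>c X Y \<cdot> Sca ?\<delta> (idn C X) \<cdot> \<theta> ?P ?Q X = ?\<iota> \<cdot> Sca ?\<sigma> (cinl C X Y) \<cdot> \<theta> ?P ?Q X"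
    using separated unfolding strongly_separated_def Let_def by simp
  also have "(?\<iota> \<cdot> Sca ?\<sigma> (cinl C X Y) \<cdot> \<theta> ?P ?Q X) \<cdot> amap \<Theta> (?p, ?q, idn C X)
      = ?\<iota> \<cdot> Sca ?\<sigma> (cinl C X Y) \<cdot> (Sca (?p \<oplus>\<^sub>m ?q) (idn C X) \<cdot> \<theta> U W X)"
    unfolding natural using u d k t by simp
  also have "\<dots> = ?\<iota> \<cdot> Sca (?\<sigma> \<cdot> (?p \<oplus>\<^sub>m ?q)) (cinl C X Y) \<cdot> \<theta> U W X"
    using u d k t by (simp add: Sc.amap_amap)
  finally show ?thesis using u d k t by (simp add: ksum_cmap[of _ ?P _ _ ?Q _ _ U _ W])
qed

lemma rho_c_context:
  "\<rho>c mu mu \<cdot> Sca \<langle>iota, gamma_v \<oplus>\<^sub>m gamma_c\<rangle> (idn C mu) \<cdot> \<theta> V K mu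
    = Ta (iota_c (mu \<oplus> mu) \<cdot> Sca (funit F (mu \<oplus> mu)) (funit F (mu \<oplus> mu))) \<cdot> \<chi> (mu \<oplus> mu) (mu \<oplus> mu)
      \<cdot> Sca (ksum C T mu mu (munit T mu \<cdot> \<iota>v) gamma_c) (cinl C mu mu) \<cdot> \<theta> V K mu"
proof -
  have "Ta (pfst C mu (Do mu mu)) \<cdot> mstr T mu (Do mu mu) \<cdot> \<langle>\<iota>v, gamma_v\<rangle> = munit T mu \<cdot> \<iota>v"
    unfolding gamma_v_def by (rule strength_munit_pair) simp_all
  then show ?thesis
    using strongly_separated_pair[of \<iota>v V mu gamma_v mu \<iota>c K gamma_c]
    by (simp add: copair_iota_summand gamma_v_eq)
qed

lemma gamma_c_context: "gamma_c \<cdot> context_inj = Ta \<iota>c \<cdot> context_step \<cdot> context_inj"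
proof -
  let ?M = "mu \<oplus> mu" and ?fold = "\<lblot>idn C mu, idn C mu\<rblot>"
  let ?s = "iota_c ?M \<cdot> Sca (funit F ?M) (funit F ?M)"
  let ?k = "ksum C T mu mu (munit T mu \<cdot> \<iota>v) gamma_c"
  have fold_k: "Ta ?fold \<cdot> ?k = total_step \<cdot> iota"
    by (simp add: codiagonal_ksum[of _ V _ _ K] cmp_iota[of _ "To mu"])
  have "gamma_c \<cdot> context_inj = (gamma_c \<cdot> Sca iota (idn C mu)) \<cdot> \<theta> V K mu"
    by (simp add: context_inj_def)
  also have "\<dots> = Ta (nabla_sharp (zero C))
      \<cdot> (\<rho>c mu mu \<cdot> Sca \<langle>iota, gamma_v \<oplus>\<^sub>m gamma_c\<rangle> (idn C mu) \<cdot> \<theta> V K mu)"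
    unfolding gamma_c_iota by (simp add: gamma_v_eq)
  also have "\<dots> = Ta (nabla_sharp (zero C) \<cdot> ?s) \<cdot> \<chi> ?M ?M \<cdot> Sca ?k (cinl C mu mu) \<cdot> \<theta> V K mu"
    unfolding rho_c_context by (simp add: T.amap_cmp)
  also have "\<dots> = Ta \<iota>c \<cdot> (Ta (Sca ?fold ?fold) \<cdot> \<chi> ?M ?M) \<cdot> Sca ?k (cinl C mu mu) \<cdot> \<theta> V K mu"
    using nabla_sharp_iota_c[of "zero C"] by (simp add: T.amap_cmp)
  also have "\<dots> = Ta \<iota>c \<cdot> (\<chi> mu mu \<cdot> Sca (Ta ?fold) ?fold) \<cdot> Sca ?k (cinl C mu mu) \<cdot> \<theta> V K mu"
    using dist_natural[of ?fold ?M mu ?fold ?M mu] by simp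
  also have "\<dots> = Ta \<iota>c \<cdot> \<chi> mu mu \<cdot> Sca (total_step \<cdot> iota) (idn C mu) \<cdot> \<theta> V K mu"
    by (simp add: Sc.amap_amap fold_k)
  also have "\<dots> = Ta \<iota>c \<cdot> context_step \<cdot> context_inj"
    by (simp add: context_step_def context_inj_def Sc.amap_amap)
  finally show ?thesis .
qed

end

section \<open>Small steps and big steps\<close>

context separated_model
begin

definition hat :: "'m \<Rightarrow> 'm" where
  "hat f = \<lblot>munit T V, f\<rblot> \<cdot> iota_inv"

definition small_step :: "'m \<Rightarrow> 'm" where
  "small_step f = lift V (hat f) \<cdot> gamma_c"

definition redex_then :: "'m \<Rightarrow> 'm" where
  "redex_then f = lift V f \<cdot> redex_step (zero C)"

definition eval_then :: "'m \<Rightarrow> 'm \<Rightarrow> 'm" where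
  "eval_then p f = lift V p \<cdot> \<chi> V mu \<cdot> Sca f (idn C mu)"

definition big_step :: "'m \<Rightarrow> 'm" where
  "big_step f = hat (eval_then (redex_then f) f)"

lemma
  assumes "f \<in> arrs C" "src C f = K" "tgt C f = To V"
  shows hat_arr [simp]: "hat f \<in> arrs C" "src C (hat f) = mu" "tgt C (hat f) = To V"
    and hat_iota [simp]: "hat f \<cdot> \<iota>v = munit T V" "hat f \<cdot> \<iota>c = f"
  using assms by (simp_all add: hat_def)

lemma redex_then_arr [simp]:
  assumes "f \<in> arrs C" "src C f = mu" "tgt C f = To V"
  shows "redex_then f \<in> arrs C" "src C (redex_then f) = Sco V mu" "tgt C (redex_then f) = To V"
  using assms by (simp_all add: redex_then_def)

lemma eval_then_arr [simp]:
  assumes "p \<in> arrs C" "src C p = Sco V mu" "tgt C p = To V"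
    "f \<in> arrs C" "src C f = mu" "tgt C f = To V"
  shows "eval_then p f \<in> arrs C" "src C (eval_then p f) = K" "tgt C (eval_then p f) = To V"
  using assms by (simp_all add: eval_then_def)

lemma small_step_arr [simp]:
  assumes "f \<in> arrs C" "src C f = K" "tgt C f = To V"
  shows "small_step f \<in> arrs C" "src C (small_step f) = K" "tgt C (small_step f) = To V"
  using assms by (simp_all add: small_step_def)

lemma hat_cmp_iota_c:
  assumes "h \<in> hom C mu (To V)" "h \<cdot> \<iota>v = munit T V"
  shows "hat (h \<cdot> \<iota>c) = h"
  by (rule mu_eqI[of _ "To V"]) (use assms in simp_all)

lemma hat_small_step:
  assumes "f \<in> hom C K (To V)"
  shows "hat (small_step f) = lift V (hat f) \<cdot> total_step"
  by (rule mu_eqI[of _ "To V"]) (use assms in \<open>simp_all add: small_step_def\<close>)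

lemma eval_then_redex:
  assumes f: "f \<in> hom C mu (To V)" "f \<cdot> \<iota>v = munit T V" and p: "p \<in> hom C (Sco V mu) (To V)"
  shows "eval_then p f \<cdot> redex_inj = p"
proof -
  have "eval_then p f \<cdot> redex_inj = lift V p \<cdot> (\<chi> V mu \<cdot> Sca (munit T V) (idn C mu))"
    using f p by (simp add: eval_then_def redex_inj_def Sc.amap_amap)
  then show ?thesis unfolding dist_munit using p by simp
qed

lemma eval_then_total_step:
  assumes f: "f \<in> hom C mu (To V)" and p: "p \<in> hom C (Sco V mu) (To V)"
  shows "eval_then p (lift V f \<cdot> total_step) = lift V (eval_then p f) \<cdot> context_step"
proof -
  let ?q = "\<chi> V mu \<cdot> Sca f (idn C mu)"
  have q: "?q \<in> hom C K (To (Sco V mu))" using f by simp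
  have "eval_then p (lift V f \<cdot> total_step) = lift V p \<cdot> lift (Sco V mu) ?q \<cdot> context_step"
    using dist_lift[OF f, of total_step mu mu] by (simp add: eval_then_def context_step_def)
  also have "\<dots> = (lift V p \<cdot> lift (Sco V mu) ?q) \<cdot> context_step" using f p by simp
  also have "\<dots> = lift V (eval_then p f) \<cdot> context_step"
    unfolding lift_lift[OF p q] by (simp add: eval_then_def)
  finally show ?thesis .
qed

lemma eval_then_unique:
  assumes p: "p \<in> hom C (Sco V mu) (To V)"
    and h: "h \<in> hom C mu (To V)" "h \<cdot> \<iota>v = munit T V" "h \<cdot> \<iota>c = eval_then p h"
    and k: "k \<in> hom C mu (To V)" "k \<cdot> \<iota>v = munit T V" "k \<cdot> \<iota>c = eval_then p k"
  shows "h = k"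
  by (rule computation_fold_eqI[of "munit T V" "To V" "lift V p \<cdot> \<chi> V mu"])
     (use p h k in \<open>simp_all add: eval_then_def\<close>)

lemma lift_gamma_c_redex:
  assumes "f \<in> hom C mu (To V)"
  shows "(lift V f \<cdot> gamma_c) \<cdot> redex_inj = redex_then f"
  using assms by (simp add: gamma_c_redex redex_then_def)

lemma beta_eq_least_fixpoint: "beta le = least_fixpoint (hom C K (To V)) (le K V) small_step"
  unfolding beta_def
proof (rule least_fixpoint_cong)
  fix f
  assume f: "f \<in> hom C K (To V)"
  have "lift V \<lblot>munit T V, f\<rblot> \<cdot> Ta iota_inv \<cdot> gamma_c
      = (lift V \<lblot>munit T V, f\<rblot> \<cdot> Ta iota_inv) \<cdot> gamma_c"
    using f by simp
  also have "lift V \<lblot>munit T V, f\<rblot> \<cdot> Ta iota_inv = lift V (hat f)"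
    unfolding hat_def using f by (intro lift_amap) simp_all
  finally show "lift V \<lblot>munit T V, f\<rblot> \<cdot> Ta iota_inv \<cdot> gamma_c = small_step f"
    by (simp add: small_step_def)
qed

lemma zeta_hat_eq_least_fixpoint:
  "zeta_hat le = least_fixpoint (hom C mu (To V)) (le mu V) big_step"
  unfolding zeta_hat_def
proof (rule least_fixpoint_cong)
  fix f
  assume f: "f \<in> hom C mu (To V)"
  let ?r = "redex_step (zero C)" and ?c = "\<chi> V mu \<cdot> Sca f (idn C mu)"
  have xi: "xi mu \<in> hom C (Sco V mu) (To (Fo mu))" by (simp add: xi_eq)
  have "Ta (Fmult (zero C)) \<cdot> lift (Fo mu) (xi mu) = lift mu ?r"
    using amap_lift[OF _ xi, of "Fmult (zero C)" mu] free_mult_xi[of "zero C"] by simp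
  then have "lift V f \<cdot> Ta (Fmult (zero C)) \<cdot> lift (Fo mu) (xi mu) \<cdot> ?c
      = (lift V f \<cdot> lift mu ?r) \<cdot> ?c"
    using f xi
      cmp_eq_extend[of "Ta (Fmult (zero C))" "lift (Fo mu) (xi mu)" "lift mu ?r" ?c] by simp
  also have "lift V f \<cdot> lift mu ?r = lift V (redex_then f)"
    unfolding redex_then_def using f by (intro lift_lift) simp_all
  finally show "\<lblot>munit T V, lift V f \<cdot> Ta (Fmult (zero C)) \<cdot> lift (Fo mu) (xi mu) \<cdot> ?c\<rblot> \<cdot> iota_inv
      = big_step f"
    by (simp add: big_step_def hat_def eval_then_def)
qed

end

context strongly_separated_model
begin

lemma lift_gamma_c_context:
  assumes f: "f \<in> hom C mu (To V)"
  shows "(lift V f \<cdot> gamma_c) \<cdot> context_inj = lift V (f \<cdot> \<iota>c) \<cdot> context_step \<cdot> context_inj"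
proof -
  have "(lift V f \<cdot> gamma_c) \<cdot> context_inj = (lift V f \<cdot> Ta \<iota>c) \<cdot> context_step \<cdot> context_inj"
    using f by (simp add: gamma_c_context)
  also have "lift V f \<cdot> Ta \<iota>c = lift V (f \<cdot> \<iota>c)" using f by (intro lift_amap) simp_all
  finally show ?thesis .
qed

lemma big_step_fixpoint_total_step:
  assumes z: "z \<in> hom C mu (To V)" "z \<cdot> \<iota>v = munit T V" "z \<cdot> \<iota>c = eval_then (redex_then z) z"
  shows "lift V z \<cdot> total_step = z"
proof -
  let ?p = "redex_then z" and ?y = "lift V z \<cdot> total_step"
  have p: "?p \<in> hom C (Sco V mu) (To V)" and y: "?y \<in> hom C mu (To V)" "?y \<cdot> \<iota>v = munit T V"
    using z(1,2) by simp_all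
  have "lift V z \<cdot> gamma_c = eval_then ?p ?y"
  proof (rule coproduct_eqI[OF coproduct_K, of _ "To V"])
    show "(lift V z \<cdot> gamma_c) \<cdot> redex_inj = eval_then ?p ?y \<cdot> redex_inj"
      unfolding eval_then_redex[OF y p] by (rule lift_gamma_c_redex[OF z(1)])
    show "(lift V z \<cdot> gamma_c) \<cdot> context_inj = eval_then ?p ?y \<cdot> context_inj"
      unfolding lift_gamma_c_context[OF z(1)] eval_then_total_step[OF z(1) p] z(3)
      using z(1) by simp
  qed (use z(1) y(1) p in simp_all)
  then have "?y \<cdot> \<iota>c = eval_then ?p ?y" using z(1) by simp
  then show ?thesis by (rule eval_then_unique[OF p y _ z])
qed

lemma big_step_fixpoint_small_step:
  assumes z: "z \<in> hom C mu (To V)" "big_step z = z"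
  shows "hat (z \<cdot> \<iota>c) = z" "small_step (z \<cdot> \<iota>c) = z \<cdot> \<iota>c"
proof -
  let ?e = "eval_then (redex_then z) z"
  have eval_arr: "?e \<in> hom C K (To V)" using z(1) by simp
  have z_eq: "z = hat ?e" using z(2) by (simp add: big_step_def)
  have value_z: "z \<cdot> \<iota>v = munit T V" and computation_z: "z \<cdot> \<iota>c = ?e"
    using hat_iota[of ?e] eval_arr z_eq by simp_all
  show hat_z: "hat (z \<cdot> \<iota>c) = z" by (rule hat_cmp_iota_c[OF z(1) value_z])
  have "small_step (z \<cdot> \<iota>c) = (lift V z \<cdot> total_step) \<cdot> \<iota>c"
    unfolding small_step_def hat_z using z(1) by simp
  then show "small_step (z \<cdot> \<iota>c) = z \<cdot> \<iota>c"
    unfolding big_step_fixpoint_total_step[OF z(1) value_z computation_z] .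
qed

definition unfold_step :: "'m \<Rightarrow> 'm \<Rightarrow> 'm" where
  "unfold_step g f = \<lblot>redex_then (hat g), lift V f \<cdot> context_step \<cdot> context_inj\<rblot>
     \<cdot> coproduct_comparison (Sco V mu) Context K redex_inj context_inj"

lemmas K_comparison = coproduct_comparison[OF coproduct_K]

lemma unfold_step_arr [simp]:
  assumes "f \<in> arrs C" "src C f = K" "tgt C f = To V" "g \<in> arrs C" "src C g = K" "tgt C g = To V"
  shows "unfold_step g f \<in> arrs C" "src C (unfold_step g f) = K" "tgt C (unfold_step g f) = To V"
  using assms K_comparison by (simp_all add: unfold_step_def)

lemma unfold_step_summand:
  assumes "f \<in> hom C K (To V)" "g \<in> hom C K (To V)"
  shows "unfold_step g f \<cdot> redex_inj = redex_then (hat g)"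
    and "unfold_step g f \<cdot> context_inj = lift V f \<cdot> context_step \<cdot> context_inj"
  using assms K_comparison by (simp_all add: unfold_step_def)

lemma small_step_eq_unfold_step:
  assumes f: "f \<in> hom C K (To V)"
  shows "small_step f = unfold_step f f"
proof (rule coproduct_eqI[OF coproduct_K, of _ "To V"])
  have hat_f: "hat f \<in> hom C mu (To V)" using f by simp
  show "small_step f \<cdot> redex_inj = unfold_step f f \<cdot> redex_inj"
    unfolding unfold_step_summand[OF f f] small_step_def by (rule lift_gamma_c_redex[OF hat_f])
  show "small_step f \<cdot> context_inj = unfold_step f f \<cdot> context_inj"
    unfolding unfold_step_summand[OF f f] small_step_def lift_gamma_c_context[OF hat_f]
    using f by simp
qed (use f in simp_all)

lemma eval_then_hat_small_step:
  assumes f: "f \<in> hom C K (To V)" and g: "g \<in> hom C K (To V)"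
  shows "eval_then (redex_then (hat g)) (hat (small_step f))
    = unfold_step g (eval_then (redex_then (hat g)) (hat f))"
proof (rule coproduct_eqI[OF coproduct_K, of _ "To V"])
  let ?p = "redex_then (hat g)"
  have p: "?p \<in> hom C (Sco V mu) (To V)" and hat_f: "hat f \<in> hom C mu (To V)"
    and eval_arr: "eval_then ?p (hat f) \<in> hom C K (To V)"
    using f g by simp_all
  show "eval_then ?p (hat (small_step f)) \<cdot> redex_inj
      = unfold_step g (eval_then ?p (hat f)) \<cdot> redex_inj"
    unfolding unfold_step_summand[OF eval_arr g] using f p by (intro eval_then_redex) simp_all
  show "eval_then ?p (hat (small_step f)) \<cdot> context_inj
      = unfold_step g (eval_then ?p (hat f)) \<cdot> context_inj"
    unfolding unfold_step_summand[OF eval_arr g] hat_small_step[OF f]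
      eval_then_total_step[OF hat_f p]
    using f p eval_arr by simp
qed (use f g in simp_all)

end

locale separated_semantics = strongly_separated_model C Sv Sc F T D \<rho>v \<rho>c \<chi> \<Theta> \<theta> +
  distributive_omega_monad C T le
  for C :: "('o, 'm) bicart" (structure) and Sv Sc F T D \<rho>v \<rho>c \<chi> le \<Theta> \<theta> +
  assumes chi_cont: "chi_omega_continuous le"
begin

sublocale continuous_split_law C T Sc \<chi> le \<Theta> \<theta>
  by unfold_locales (use chi_cont in \<open>simp add: chi_omega_continuous_def\<close>)

lemma hat_cont: "omega_cont (hom C K (To V)) (le K V) (hom C mu (To V)) (le mu V) hat"
  unfolding hat_def[abs_def]
  by (rule omega_cont_compose[OF copair_right_cont precomp_cont hom_omega_cpo]) simp_all

lemma small_step_cont: "omega_cont (hom C K (To V)) (le K V) (hom C K (To V)) (le K V) small_step"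
  unfolding small_step_def[abs_def]
  by (rule omega_cont_compose[OF hat_cont klift_cont_right hom_omega_cpo]) simp

lemma eval_then_hat_cont:
  assumes p: "p \<in> hom C (Sco V mu) (To V)"
  shows "omega_cont (hom C K (To V)) (le K V) (hom C K (To V)) (le K V) (\<lambda>f. eval_then p (hat f))"
proof -
  have "omega_cont (hom C mu (To V)) (le mu V) (hom C K (To (Sco V mu))) (le K (Sco V mu))
      (\<lambda>f. \<chi> V mu \<cdot> Sca f (idn C mu))"
    using dist_cont[where Z = mu and X = mu and Y = V] by simp
  from omega_cont_compose[OF this klift_cont_left[OF p] hom_omega_cpo]
  have "omega_cont (hom C mu (To V)) (le mu V) (hom C K (To V)) (le K V) (eval_then p)"
    by (simp add: eval_then_def[abs_def])
  then show ?thesis by (rule omega_cont_compose[OF hat_cont _ hom_omega_cpo])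
qed

lemma le_unfold_step:
  assumes le: "le K V g g'" "le K V f f'"
    and arr: "g \<in> hom C K (To V)" "g' \<in> hom C K (To V)" "f \<in> hom C K (To V)" "f' \<in> hom C K (To V)"
  shows "le K V (unfold_step g f) (unfold_step g' f')"
proof (rule le_coproductI[OF coproduct_K])
  note summands = unfold_step_summand[OF arr(3,1)] unfold_step_summand[OF arr(4,2)]
  have "le mu V (hat g) (hat g')"
    by (rule omega_cont_mono[OF hat_cont hom_omega_cpo le(1) arr(1,2)])
  then show "le (Sco V mu) V (unfold_step g f \<cdot> redex_inj) (unfold_step g' f' \<cdot> redex_inj)"
    unfolding summands redex_then_def by (rule le_lift_left) (use arr in simp_all)
  show "le Context V (unfold_step g f \<cdot> context_inj) (unfold_step g' f' \<cdot> context_inj)"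
    unfolding summands by (rule le_lift_left[OF le(2) arr(3,4)]) simp
qed (use arr in simp_all)

lemma eval_then_bot_le:
  assumes b: "is_bot (hom C K (To V)) (le K V) b" and p: "p \<in> hom C (Sco V mu) (To V)"
    and g: "g \<in> hom C K (To V)" "g \<cdot> redex_inj = p"
  shows "le K V (eval_then p (hat b)) g"
proof (rule le_coproductI[OF coproduct_K])
  have b_arr: "b \<in> hom C K (To V)" using b unfolding is_bot_def by blast
  show "le (Sco V mu) V (eval_then p (hat b) \<cdot> redex_inj) (g \<cdot> redex_inj)"
    using b_arr g(2) eval_then_redex[OF _ _ p, of "hat b"] le_refl[OF p] by simp
  let ?c = "\<chi> V mu \<cdot> Sca \<lblot>munit T V, b\<rblot> (idn C mu) \<cdot> \<theta> V K mu"
  have "is_bot (hom C Context (To V)) (le Context V) (lift V p \<cdot> ?c)"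
    by (rule klift_bot[OF p dist_copair_bot[OF b]])
  moreover have "eval_then p (hat b) \<cdot> context_inj = lift V p \<cdot> ?c"
    using b_arr p by (simp add: eval_then_def hat_def context_inj_def Sc.amap_amap)
  ultimately show "le Context V (eval_then p (hat b) \<cdot> context_inj) (g \<cdot> context_inj)"
    using g(1) unfolding is_bot_def by simp
qed (use b p g in \<open>simp_all add: is_bot_def\<close>)

lemma is_least_fixpoint_beta: "is_least_fixpoint (hom C K (To V)) (le K V) small_step (beta le)"
  unfolding beta_eq_least_fixpoint
  by (rule is_least_fixpoint_least_fixpoint[OF hom_omega_cpo small_step_cont])

lemma beta_arr [simp]: "beta le \<in> arrs C" "src C (beta le) = K" "tgt C (beta le) = To V"
  using is_least_fixpoint_beta unfolding is_least_fixpoint_def by auto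

theorem beta_eq_eval_then: "beta le = eval_then (redex_then (hat (beta le))) (hat (beta le))"
proof -
  let ?p = "redex_then (hat (beta le))"
  let ?lfp = "is_least_fixpoint (hom C K (To V)) (le K V) (unfold_step (beta le))"
  have "?lfp (beta le)"
    unfolding beta_eq_least_fixpoint
    by (rule least_fixpoint_diagonal[OF hom_omega_cpo small_step_cont])
       (fact small_step_eq_unfold_step le_unfold_step)+
  moreover have "?lfp (eval_then ?p (hat (least_fixpoint (hom C K (To V)) (le K V) small_step)))"
  proof (rule least_fixpoint_fusion[OF hom_omega_cpo small_step_cont])
    show "omega_cont (hom C K (To V)) (le K V) (hom C K (To V)) (le K V) (\<lambda>f. eval_then ?p (hat f))"
      by (rule eval_then_hat_cont) simp
    show "eval_then ?p (hat (small_step f)) = unfold_step (beta le) (eval_then ?p (hat f))"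
      if "f \<in> hom C K (To V)" for f
      by (rule eval_then_hat_small_step[OF that]) simp
    show "le K V (unfold_step (beta le) f) (unfold_step (beta le) g)"
      if "le K V f g" "f \<in> hom C K (To V)" "g \<in> hom C K (To V)" for f g
      using that by (intro le_unfold_step le_refl) simp_all
    show "le K V (eval_then ?p (hat b)) g"
      if "is_bot (hom C K (To V)) (le K V) b" "g \<in> hom C K (To V)" "unfold_step (beta le) g = g"
      for b g
      using that unfold_step_summand(1)[of g "beta le"] by (intro eval_then_bot_le) simp_all
  qed
  ultimately show ?thesis
    unfolding beta_eq_least_fixpoint[symmetric] by (rule is_least_fixpoint_unique[OF hom_omega_cpo])
qed

theorem zeta_hat_eq_beta_hat: "zeta_hat le = beta_hat le"
proof -
  have "is_least_fixpoint (hom C mu (To V)) (le mu V) big_step (hat (beta le))"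
    unfolding is_least_fixpoint_def
  proof (intro conjI ballI impI)
    show "big_step (hat (beta le)) = hat (beta le)"
      by (simp add: big_step_def flip: beta_eq_eval_then)
    fix z
    assume z: "z \<in> hom C mu (To V)" "big_step z = z"
    note fixpoint = big_step_fixpoint_small_step[OF z]
    have z_arr: "z \<cdot> \<iota>c \<in> hom C K (To V)" using z(1) by simp
    then have "le K V (beta le) (z \<cdot> \<iota>c)"
      using is_least_fixpoint_beta fixpoint(2) unfolding is_least_fixpoint_def by blast
    then have "le mu V (hat (beta le)) (hat (z \<cdot> \<iota>c))"
      by (rule omega_cont_mono[OF hat_cont hom_omega_cpo _ _ z_arr]) simp
    then show "le mu V (hat (beta le)) z" unfolding fixpoint(1) .
  qed simp
  then have "zeta_hat le = hat (beta le)"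
    unfolding zeta_hat_eq_least_fixpoint by (rule least_fixpoint_eqI[OF hom_omega_cpo])
  then show ?thesis by (simp add: beta_hat_def hat_def)
qed

end

theorem theorem5p4:
  fixes C :: "('o, 'm) bicart"
    and Sv :: "('o, 'm, 'o, 'm) func"
    and Sc :: "('o \<times> 'o, 'm \<times> 'm, 'o, 'm) func"
    and F :: "('o, 'm) free_algs"
    and D :: "('o \<times> 'o, 'm \<times> 'm, 'o, 'm) func"
    and \<Theta> :: "('o \<times> 'o \<times> 'o, 'm \<times> 'm \<times> 'm, 'o, 'm) func"
    and \<theta> :: "'o \<Rightarrow> 'o \<Rightarrow> 'o \<Rightarrow> 'm"
    and T :: "('o, 'm) smonad"
    and le :: "'o \<Rightarrow> 'o \<Rightarrow> 'm \<Rightarrow> 'm \<Rightarrow> bool"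
    and \<rho>v :: "'o \<Rightarrow> 'm"
    and \<rho>c :: "'o \<Rightarrow> 'o \<Rightarrow> 'm"
    and \<chi> :: "'o \<Rightarrow> 'o \<Rightarrow> 'm"
  assumes "distributive_category C"
    and "is_functor C C Sv"
    and "is_functor (C \<times>\<^sub>C C) C Sc"
    and "free_algebras C (sig_functor C Sv Sc) F"
    and "is_functor (op_cat C \<times>\<^sub>C C) C D"
    and "computation_splitting C Sc \<Theta> \<theta>"
    and "omega_continuous_monad C T le"
    and "separated_law C Sv Sc F T D \<rho>v \<rho>c \<chi>"
    and "hogsos.strongly_separated C Sv Sc F T D \<rho>c \<chi> \<theta>"
    and "hogsos.chi_omega_continuous C Sc T \<chi> le"
  shows "hogsos.zeta_hat C Sv Sc F T D \<rho>v \<rho>c \<chi> le = hogsos.beta_hat C Sv Sc F T D \<rho>v \<rho>c le"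
proof -
  interpret distributive_category C by fact
  interpret omega_continuous_monad C T le by fact
  interpret separated_law C Sv Sc F T D \<rho>v \<rho>c \<chi> by fact
  interpret computation_splitting C Sc \<Theta> \<theta> by fact
  interpret separated_semantics C Sv Sc F T D \<rho>v \<rho>c \<chi> le \<Theta> \<theta>
    by unfold_locales (fact assms)+
  show ?thesis by (rule zeta_hat_eq_beta_hat)
qed

end
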